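(* Let $A$ be a closed symmetric linear relation in a Hilbert space $\mathfrak H$ with defect numbers $n_\pm(A)=p<\infty$, let $\mathfrak H_+\subset\mathfrak H\subset\mathfrak H_-$ be the rigging associated with $A$, let $\widehat\Pi=(\mathbb C^p,\widehat\Gamma_0,\widehat\Gamma_1)$ be an extended boundary triple for $A^{\langle*\rangle}$ (the extension of a boundary triple $(\mathbb C^p,\Gamma_0,\Gamma_1)$ for $A^*$, with $A_0=\ker\Gamma_0$), and let $\mathbf R^0$ be the regularizer built from $A_0$. Let $\widehat f=\mathrm{col}\{f,\mathfrak f'\}$, $\widehat g=\mathrm{col}\{g,\mathfrak g'\}\in A^{\langle*\rangle}$ and let $\widetilde f,\widetilde g\in\mathfrak H_-$ be such that $\mathfrak f'+\widetilde f\in\mathfrak H$ and $\mathfrak g'+\widetilde g\in\mathfrak H$. Then: (i) $f+\mathbf R^0\widetilde f\in\mathfrak H_+$ and $g+\mathbf R^0\widetilde g\in\mathfrak H_+$; (ii) the following equality holds: $$(\mathfrak f'+\widetilde f,g)_{\mathfrak H}-(f,\mathfrak g'+\widetilde g)_{\mathfrak H}=(\widehat\Gamma_0\widehat g)^*(\widehat\Gamma_1\widehat f)-(\widehat\Gamma_1\widehat g)^*(\widehat\Gamma_0\widehat f)-\langle f+\mathbf R^0\widetilde f,\widetilde g\rangle_{+,-}+\langle\widetilde f,g+\mathbf R^0\widetilde g\rangle_{-,+}.$$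
   Context: Inner products are linear in the first argument. A linear relation $T$ in $\mathfrak H$ is a linear subspace of $\mathfrak H\times\mathfrak H$; $\mathrm{col}\{f,g\}$ denotes an element; $\mathrm{mul}\,T=\{g:\mathrm{col}\{0,g\}\in T\}$; $T^*=\{\mathrm{col}\{u,f\}:(f,v)=(u,g)\ \forall\,\mathrm{col}\{v,g\}\in T\}$. $A$ is symmetric if $A\subseteq A^*$. $\mathfrak N_z=\ker(A^*-zI)$, $\widehat{\mathfrak N}_z=\{\mathrm{col}\{f,zf\}:f\in\mathfrak N_z\}$; $n_\pm(A)=\dim\mathfrak N_z$, $z\in\mathbb C_\pm$. Boundary triple for $A^*$: linear maps $\Gamma_0,\Gamma_1:A^*\to\mathbb C^p$ with $(f',g)-(f,g')=(\Gamma_0\widehat g)^*(\Gamma_1\widehat f)-(\Gamma_1\widehat g)^*(\Gamma_0\widehat f)$ for all $\widehat f=\mathrm{col}\{f,f'\},\widehat g=\mathrm{col}\{g,g'\}\in A^*$ and $\mathrm{col}\{\Gamma_0,\Gamma_1\}:A^*\to\mathbb C^{2p}$ surjective. $A_0=\ker\Gamma_0$ (a selfadjoint extension of $A$), $R_z^0=(A_0-zI)^{-1}$; for $z\in\rho(A_0)$, $\widehat\gamma(z)=(\Gamma_0\upharpoonright\widehat{\mathfrak N}_z)^{-1}$ and $\gamma(z)$ is its first component. Rigging associated with $A$: let $\mathfrak H_0=\overline{\mathrm{dom}\,A}$. $\mathfrak H_+=\mathrm{dom}\,A^*\oplus\mathrm{mul}\,A$ with norm $\|h_0+h_1\|_+^2=\|h_0\|^2+\|P_{\mathfrak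 H_0}h_0'\|^2+\|h_1\|^2$ for $h_0\in\mathrm{dom}\,A^*$, $h_1\in\mathrm{mul}\,A$, $\mathrm{col}\{h_0,h_0'\}\in A^*$. $\mathfrak H_-$ is the space of bounded conjugate-linear functionals on $\mathfrak H_+$, $\langle\mathfrak f,h\rangle_{-,+}:=\mathfrak f(h)$, $\langle h,\mathfrak f\rangle_{+,-}:=\overline{\langle\mathfrak f,h\rangle_{-,+}}$; $f\in\mathfrak H$ is identified with $h\mapsto(f,h)_{\mathfrak H}$. For $T\in\mathcal B(\mathfrak H,\mathfrak H_+)$ the operator $T^{\langle*\rangle}\in\mathcal B(\mathfrak H_-,\mathfrak H)$ is defined by $(T^{\langle*\rangle}\mathfrak f,g)_{\mathfrak H}=\langle\mathfrak f,Tg\rangle_{-,+}$. Put $\widetilde R_z^0=(R_{\bar z}^0)^{\langle*\rangle}$. The regularizer is $\mathbf R^0=(R^0)^{\langle*\rangle}\in\mathcal B(\mathfrak H_-,\mathfrak H)$, where $R^0=\frac12(R_i^0+R_{-i}^0)\in\mathcal B(\mathfrak H,\mathfrak H_+)$. $A^{\langle*\rangle}$ is the set of $\mathrm{col}\{f,\mathfrak f'\}\in\mathfrak H\times\mathfrak H_-$ with $\langle\mathfrak f',h\rangle_{-,+}=(f,h')_{\mathfrak H}$ for all $\mathrm{col}\{h,h'\}\in A$; $\mathbf A_0$ is defined in the same way with $A_0$ in place of $A$. One has $\mathbf A_0=\{\mathrm{col}\{\widetilde R_z^0\mathfrak f,\mathfrak f+z\widetilde R_z^0\mathfrak f\}:\mathfrak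 f\in\mathfrak H_-\}$ and $A^{\langle*\rangle}=\mathbf A_0\dotplus\widehat{\mathfrak N}_z$ for $z\in\rho(A_0)$. The extended boundary triple consists of the bounded (in the topology of $\mathfrak H\times\mathfrak H_-$) continuations $\widehat\Gamma_j:A^{\langle*\rangle}\to\mathbb C^p$ of $\Gamma_j$; they satisfy $\widehat\Gamma_0\,\mathrm{col}\{\widetilde R_z^0\mathfrak f,\mathfrak f+z\widetilde R_z^0\mathfrak f\}=0$, $\widehat\Gamma_1\,\mathrm{col}\{\widetilde R_z^0\mathfrak f,\mathfrak f+z\widetilde R_z^0\mathfrak f\}=\gamma(\bar z)^{\langle*\rangle}\mathfrak f$, and $\widehat\Gamma_j=\Gamma_j$ on $\widehat{\mathfrak N}_z$, where $\xi^*(\gamma(\bar z)^{\langle*\rangle}\mathfrak f)=\langle\mathfrak f,\gamma(\bar z)\xi\rangle_{-,+}$, $\xi\in\mathbb C^p$. *)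

theory Defs
  imports
    "HOL-Analysis.Elementary_Metric_Spaces"
    "HOL-Analysis.L2_Norm"
    "HOL-Analysis.Inner_Product"
    "HOL-Analysis.Product_Vector"
    "HOL-Library.Function_Algebras"
    "Jordan_Normal_Form.Matrix"
begin

section \<open>Complex Hilbert spaces\<close>

text \<open>The distribution only has real inner product spaces.  A complex Hilbert space is a
  complete real inner product space with a compatible complex structure; the real inner product
  (hence the norm and the topology) is the real part of the complex one, which is linear in its
  first argument.\<close>

class complex_hilbert_space = real_inner + complete_space +
  fixes scaleC :: "complex \<Rightarrow> 'a \<Rightarrow> 'a"  (infixr \<open>*\<^sub>C\<close> 75)
    and cinner :: "'a \<Rightarrow> 'a \<Rightarrow> complex"
  assumes scaleC_add_right: "c *\<^sub>C (x + y) = c *\<^sub>C x + c *\<^sub>C y"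
    and scaleC_add_left: "(c + d) *\<^sub>C x = c *\<^sub>C x + d *\<^sub>C x"
    and scaleC_scaleC: "c *\<^sub>C d *\<^sub>C x = (c * d) *\<^sub>C x"
    and scaleC_one: "1 *\<^sub>C x = x"
    and scaleR_scaleC: "r *\<^sub>R x = complex_of_real r *\<^sub>C x"
    and cinner_commute: "cinner x y = cnj (cinner y x)"
    and cinner_add_left: "cinner (x + y) z = cinner x z + cinner y z"
    and cinner_scaleC_left: "cinner (c *\<^sub>C x) y = c * cinner x y"
    and inner_eq_Re_cinner: "inner x y = Re (cinner x y)"

global_interpretation complex_vector:
  vector_space "scaleC :: complex \<Rightarrow> 'a \<Rightarrow> 'a::complex_hilbert_space"
  by standard (simp_all add: scaleC_add_right scaleC_add_left scaleC_scaleC scaleC_one)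

text \<open>Unlike the library constant \<open>dim\<close>, which is \<open>0\<close> on spaces without a finite basis, this
  includes finite-dimensionality.\<close>

definition has_cdim :: "'a::complex_hilbert_space set \<Rightarrow> nat \<Rightarrow> bool" where
  "has_cdim S n \<longleftrightarrow>
     (\<exists>B. finite B \<and> card B = n \<and> complex_vector.independent B \<and> complex_vector.span B = S)"

definition orth_proj :: "'a::complex_hilbert_space set \<Rightarrow> 'a \<Rightarrow> 'a" where
  "orth_proj S x = (THE y. y \<in> S \<and> (\<forall>s\<in>S. cinner (x - y) s = 0))"

section \<open>Linear relations\<close>

text \<open>The domain of a relation is \<^const>\<open>Domain\<close>.\<close>

definition scale_rel :: "complex \<Rightarrow> 'a \<times> 'a \<Rightarrow> 'a::complex_hilbert_space \<times> 'a" where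
  "scale_rel c x = (c *\<^sub>C fst x, c *\<^sub>C snd x)"

definition linear_relation :: "('a::complex_hilbert_space \<times> 'a) set \<Rightarrow> bool" where
  "linear_relation T \<longleftrightarrow> 0 \<in> T \<and> (\<forall>x\<in>T. \<forall>y\<in>T. x + y \<in> T) \<and> (\<forall>c. \<forall>x\<in>T. scale_rel c x \<in> T)"

definition mul_rel :: "('a::complex_hilbert_space \<times> 'a) set \<Rightarrow> 'a set" where
  "mul_rel T = {g. (0, g) \<in> T}"

definition adjoint_rel :: "('a::complex_hilbert_space \<times> 'a) set \<Rightarrow> ('a \<times> 'a) set" where
  "adjoint_rel T = {(u, f). \<forall>(v, g)\<in>T. cinner f v = cinner u g}"

definition symmetric_rel :: "('a::complex_hilbert_space \<times> 'a) set \<Rightarrow> bool" where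
  "symmetric_rel A \<longleftrightarrow> A \<subseteq> adjoint_rel A"

text \<open>\<open>\<NN>\<^sub>z = ker (A\<^sup>* - z I)\<close>\<close>

definition defect_space :: "('a::complex_hilbert_space \<times> 'a) set \<Rightarrow> complex \<Rightarrow> 'a set" where
  "defect_space A z = {f. (f, z *\<^sub>C f) \<in> adjoint_rel A}"

definition defect_numbers ::
    "('a::complex_hilbert_space \<times> 'a) set \<Rightarrow> nat \<Rightarrow> nat \<Rightarrow> bool" where
  "defect_numbers A n_plus n_minus \<longleftrightarrow>
     (\<forall>z. Im z > 0 \<longrightarrow> has_cdim (defect_space A z) n_plus) \<and>
     (\<forall>z. Im z < 0 \<longrightarrow> has_cdim (defect_space A z) n_minus)"

text \<open>\<open>(T - z I)\<^sup>-\<^sup>1\<close> as a function; only meaningful for \<open>z\<close> in the resolvent set of \<open>T\<close>.\<close>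

definition resolvent_rel ::
    "('a::complex_hilbert_space \<times> 'a) set \<Rightarrow> complex \<Rightarrow> 'a \<Rightarrow> 'a" where
  "resolvent_rel T z h = (THE f. \<exists>f'. (f, f') \<in> T \<and> f' - z *\<^sub>C f = h)"

section \<open>Boundary triples\<close>

text \<open>The space \<open>\<complex>\<^sup>p\<close> is \<^term>\<open>carrier_vec p :: complex vec set\<close>, which allows \<open>p = 0\<close>.
  In terms of column vectors, \<open>v\<^sup>* u\<close> is \<^term>\<open>u \<bullet>c v\<close>, i.e. \<open>\<Sum>i<p. u $ i * cnj (v $ i)\<close>.\<close>

definition linear_to_vec ::
    "nat \<Rightarrow> (complex \<Rightarrow> 'x \<Rightarrow> 'x) \<Rightarrow> 'x::plus set \<Rightarrow> ('x \<Rightarrow> complex vec) \<Rightarrow> bool" where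
  "linear_to_vec p scl D \<Gamma> \<longleftrightarrow>
     (\<forall>x\<in>D. \<Gamma> x \<in> carrier_vec p) \<and>
     (\<forall>x\<in>D. \<forall>y\<in>D. \<Gamma> (x + y) = \<Gamma> x + \<Gamma> y) \<and>
     (\<forall>c. \<forall>x\<in>D. \<Gamma> (scl c x) = c \<cdot>\<^sub>v \<Gamma> x)"

definition boundary_triple ::
    "nat \<Rightarrow> ('a::complex_hilbert_space \<times> 'a) set
      \<Rightarrow> ('a \<times> 'a \<Rightarrow> complex vec) \<Rightarrow> ('a \<times> 'a \<Rightarrow> complex vec) \<Rightarrow> bool" where
  "boundary_triple p A \<Gamma>\<^sub>0 \<Gamma>\<^sub>1 \<longleftrightarrow>
     linear_to_vec p scale_rel (adjoint_rel A) \<Gamma>\<^sub>0 \<and>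
     linear_to_vec p scale_rel (adjoint_rel A) \<Gamma>\<^sub>1 \<and>
     (\<forall>(f, f')\<in>adjoint_rel A. \<forall>(g, g')\<in>adjoint_rel A.
        cinner f' g - cinner f g' =
          \<Gamma>\<^sub>1 (f, f') \<bullet>c \<Gamma>\<^sub>0 (g, g') - \<Gamma>\<^sub>0 (f, f') \<bullet>c \<Gamma>\<^sub>1 (g, g')) \<and>
     (\<forall>u\<in>carrier_vec p. \<forall>v\<in>carrier_vec p. \<exists>x\<in>adjoint_rel A. \<Gamma>\<^sub>0 x = u \<and> \<Gamma>\<^sub>1 x = v)"

text \<open>\<open>A\<^sub>0 = ker \<Gamma>\<^sub>0\<close>\<close>

definition ker_ext ::
    "nat \<Rightarrow> ('a::complex_hilbert_space \<times> 'a) set \<Rightarrow> ('a \<times> 'a \<Rightarrow> complex vec)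
      \<Rightarrow> ('a \<times> 'a) set" where
  "ker_ext p A \<Gamma>\<^sub>0 = {x \<in> adjoint_rel A. \<Gamma>\<^sub>0 x = 0\<^sub>v p}"

section \<open>The rigging associated with a symmetric linear relation\<close>

definition H_plus :: "('a::complex_hilbert_space \<times> 'a) set \<Rightarrow> 'a set" where
  "H_plus A = {h\<^sub>0 + h\<^sub>1 | h\<^sub>0 h\<^sub>1. h\<^sub>0 \<in> Domain (adjoint_rel A) \<and> h\<^sub>1 \<in> mul_rel A}"

text \<open>The value does not depend on the representation \<open>h = h\<^sub>0 + h\<^sub>1\<close> (the sum is orthogonal) nor on
  \<open>h\<^sub>0'\<close> (two choices differ by an element of \<open>mul A\<^sup>* = (dom A)\<^sup>\<bottom>\<close>).\<close>

definition norm_plus :: "('a::complex_hilbert_space \<times> 'a) set \<Rightarrow> 'a \<Rightarrow> real" where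
  "norm_plus A h = (THE r. \<exists>h\<^sub>0 h\<^sub>0' h\<^sub>1. (h\<^sub>0, h\<^sub>0') \<in> adjoint_rel A \<and> h\<^sub>1 \<in> mul_rel A \<and> h = h\<^sub>0 + h\<^sub>1 \<and>
     r = sqrt ((norm h\<^sub>0)\<^sup>2 + (norm (orth_proj (closure (Domain A)) h\<^sub>0'))\<^sup>2 + (norm h\<^sub>1)\<^sup>2))"

text \<open>A functional on \<open>\<HH>\<^sub>+\<close> is a function on the whole type that vanishes outside \<open>\<HH>\<^sub>+\<close>, so that
  equality of functionals is equality of functions and the vector space operations are pointwise.
  The pairing of \<open>\<phi> \<in> \<HH>\<^sub>-\<close> with \<open>h \<in> \<HH>\<^sub>+\<close> is application \<open>\<phi> h\<close>, and the pairing of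
  \<open>h\<close> with \<open>\<phi>\<close> in the opposite order is \<open>cnj (\<phi> h)\<close>.\<close>

definition H_minus :: "('a::complex_hilbert_space \<times> 'a) set \<Rightarrow> ('a \<Rightarrow> complex) set" where
  "H_minus A = {\<phi>.
     (\<forall>h\<in>H_plus A. \<forall>k\<in>H_plus A. \<phi> (h + k) = \<phi> h + \<phi> k) \<and>
     (\<forall>c. \<forall>h\<in>H_plus A. \<phi> (c *\<^sub>C h) = cnj c * \<phi> h) \<and>
     (\<exists>K. \<forall>h\<in>H_plus A. cmod (\<phi> h) \<le> K * norm_plus A h) \<and>
     (\<forall>h. h \<notin> H_plus A \<longrightarrow> \<phi> h = 0)}"

definition norm_minus ::
    "('a::complex_hilbert_space \<times> 'a) set \<Rightarrow> ('a \<Rightarrow> complex) \<Rightarrow> real" where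
  "norm_minus A \<phi> = (SUP h \<in> {h \<in> H_plus A. norm_plus A h \<le> 1}. cmod (\<phi> h))"

text \<open>The identification of \<open>\<HH>\<close> with a subspace of \<open>\<HH>\<^sub>-\<close>.\<close>

definition embed_minus ::
    "('a::complex_hilbert_space \<times> 'a) set \<Rightarrow> 'a \<Rightarrow> 'a \<Rightarrow> complex" where
  "embed_minus A f = (\<lambda>h. if h \<in> H_plus A then cinner f h else 0)"

text \<open>\<open>T\<^sup>\<langle>\<^sup>*\<^sup>\<rangle> \<phi>\<close> for \<open>T \<in> \<B>(\<HH>, \<HH>\<^sub>+)\<close> and \<open>\<phi> \<in> \<HH>\<^sub>-\<close>.\<close>

definition rigged_adjoint :: "('a \<Rightarrow> 'a) \<Rightarrow> ('a \<Rightarrow> complex) \<Rightarrow> 'a::complex_hilbert_space" where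
  "rigged_adjoint T \<phi> = (THE u. \<forall>g. cinner u g = \<phi> (T g))"

definition regularizer ::
    "('a \<times> 'a) set \<Rightarrow> ('a \<Rightarrow> complex) \<Rightarrow> 'a::complex_hilbert_space" where
  "regularizer A\<^sub>0 =
     rigged_adjoint (\<lambda>h. (1/2) *\<^sub>C (resolvent_rel A\<^sub>0 \<i> h + resolvent_rel A\<^sub>0 (- \<i>) h))"

text \<open>\<open>A\<^sup>\<langle>\<^sup>*\<^sup>\<rangle>\<close>, a subspace of \<open>\<HH> \<times> \<HH>\<^sub>-\<close>.\<close>

definition rigged_adjoint_rel ::
    "('a::complex_hilbert_space \<times> 'a) set \<Rightarrow> ('a \<times> ('a \<Rightarrow> complex)) set" where
  "rigged_adjoint_rel A = {(f, \<phi>). \<phi> \<in> H_minus A \<and> (\<forall>(h, h')\<in>A. \<phi> h = cinner f h')}"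

section \<open>Extended boundary triples\<close>

definition scale_rigged ::
    "complex \<Rightarrow> 'a \<times> ('a \<Rightarrow> complex) \<Rightarrow> 'a::complex_hilbert_space \<times> ('a \<Rightarrow> complex)" where
  "scale_rigged c x = (c *\<^sub>C fst x, (\<lambda>h. c * snd x h))"

text \<open>\<open>G\<close> is a linear continuation of \<open>\<Gamma>\<close> from \<open>A\<^sup>*\<close> to \<open>A\<^sup>\<langle>\<^sup>*\<^sup>\<rangle>\<close>, bounded with respect to the norm of
  \<open>\<HH> \<times> \<HH>\<^sub>-\<close>.\<close>

definition bounded_continuation ::
    "nat \<Rightarrow> ('a::complex_hilbert_space \<times> 'a) set \<Rightarrow> ('a \<times> 'a \<Rightarrow> complex vec)
      \<Rightarrow> ('a \<times> ('a \<Rightarrow> complex) \<Rightarrow> complex vec) \<Rightarrow> bool" where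
  "bounded_continuation p A \<Gamma> G \<longleftrightarrow>
     linear_to_vec p scale_rigged (rigged_adjoint_rel A) G \<and>
     (\<exists>K. \<forall>(f, \<phi>)\<in>rigged_adjoint_rel A.
        L2_set (\<lambda>i. cmod (G (f, \<phi>) $ i)) {..<p} \<le> K * (norm f + norm_minus A \<phi>)) \<and>
     (\<forall>(f, f')\<in>adjoint_rel A. G (f, embed_minus A f') = \<Gamma> (f, f'))"

definition extended_boundary_triple ::
    "nat \<Rightarrow> ('a::complex_hilbert_space \<times> 'a) set
      \<Rightarrow> ('a \<times> 'a \<Rightarrow> complex vec) \<Rightarrow> ('a \<times> 'a \<Rightarrow> complex vec)
      \<Rightarrow> ('a \<times> ('a \<Rightarrow> complex) \<Rightarrow> complex vec)
      \<Rightarrow> ('a \<times> ('a \<Rightarrow> complex) \<Rightarrow> complex vec) \<Rightarrow> bool" where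
  "extended_boundary_triple p A \<Gamma>\<^sub>0 \<Gamma>\<^sub>1 G\<^sub>0 G\<^sub>1 \<longleftrightarrow>
     boundary_triple p A \<Gamma>\<^sub>0 \<Gamma>\<^sub>1 \<and>
     bounded_continuation p A \<Gamma>\<^sub>0 G\<^sub>0 \<and> bounded_continuation p A \<Gamma>\<^sub>1 G\<^sub>1"

end

theory Submission
  imports Defs "HOL-Analysis.Euclidean_Space"
begin

text \<open>Write \<open>R\<close> for the regularizer and \<open>S = - (1 + A\<^sub>0\<^sup>2)\<^sup>-\<^sup>1\<close>, extended to \<open>\<HH>\<^sub>-\<close>.  For \<open>\<psi> \<in> \<HH>\<^sub>-\<close> the
  pair \<open>(R \<psi>, \<psi> + S \<psi>)\<close> lies in \<open>\<^bold>A\<^sub>0\<close>.  Adding it with \<open>\<psi> = ft\<close> to \<open>(f, f')\<close> cancels the singular part and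
  gives \<open>(f + R ft, u + S ft) \<in> A\<^sup>*\<close>, which is (i).  For (ii), apply Green's identity on \<open>A\<^sup>*\<close> to this
  element and its analogue for \<open>g\<close>.  The boundary values of \<open>(R \<psi>, \<psi> + S \<psi>)\<close> that come in are
  determined by extending Green's identity from \<open>\<psi> \<in> \<HH>\<close> to \<open>\<psi> \<in> \<HH>\<^sub>-\<close> by density, and the remaining terms
  cancel because \<open>(R ft, S gt) = (S ft, R gt)\<close>.\<close>

section \<open>Orthogonal projection and the Riesz representation\<close>

text \<open>An extended triple is only required to consist of bounded linear maps
  \<open>G\<^sub>0\<close>, \<open>G\<^sub>1\<close> that agree with
  \<open>\<Gamma>\<^sub>0\<close>, \<open>\<Gamma>\<^sub>1\<close> on the adjoint. Their values on
  the singular pairs have to be computed, and continuity is the only handle on them. Density of the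
  Hilbert space in \<open>H_minus A\<close> is therefore needed; since \<open>A\<close> may be
  multivalued and not densely defined, it is proved in a closed real subspace of a triple product.
  The average over both points \<open>\<i>\<close> and \<open>- \<i>\<close> is what closes the
  computation. With the single pair \<open>R_z \<psi>\<close>, \<open>\<psi> + z R_z \<psi>\<close>
  the same calculation would leave the term \<open>(z - cnj z) (R_z ft, R_z gt)\<close>. For the
  average the second components differ from \<open>\<psi>\<close> by vectors in the domain of the
  relation \<open>ker_ext p A \<Gamma>\<^sub>0\<close>, whose symmetry removes the leftover. At
  these two points one norm identity gives uniqueness and bounds of the resolvent, so no further
  spectral theory enters.\<close>

lemma subspace_closure:
  fixes S :: "'b::real_normed_vector set"
  assumes "subspace S"
  shows "subspace (closure S)"
proof (rule subspaceI)
  show "0 \<in> closure S"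
    using assms closure_subset subspace_0 by blast
next
  fix x y assume "x \<in> closure S" "y \<in> closure S"
  then obtain s t where "\<forall>n. s n \<in> S" "s \<longlonglongrightarrow> x" "\<forall>n. t n \<in> S" "t \<longlonglongrightarrow> y"
    unfolding closure_sequential by blast
  then have "\<forall>n. s n + t n \<in> S" "(\<lambda>n. s n + t n) \<longlonglongrightarrow> x + y"
    using assms by (auto intro: subspace_add tendsto_add)
  then show "x + y \<in> closure S"
    unfolding closure_sequential by (intro exI conjI)
next
  fix x and c :: real assume "x \<in> closure S"
  then obtain s where "\<forall>n. s n \<in> S" "s \<longlonglongrightarrow> x"
    unfolding closure_sequential by blast
  then have "\<forall>n. c *\<^sub>R s n \<in> S" "(\<lambda>n. c *\<^sub>R s n) \<longlonglongrightarrow> c *\<^sub>R x"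
    using assms by (auto intro: subspace_scale tendsto_intros)
  then show "c *\<^sub>R x \<in> closure S"
    unfolding closure_sequential by (intro exI conjI)
qed

lemma nearest_point_orthogonal:
  fixes S :: "'b::real_inner set"
  assumes S: "subspace S" and y: "y \<in> S"
    and min: "\<And>s. s \<in> S \<Longrightarrow> (norm (x - y))\<^sup>2 \<le> (norm (x - s))\<^sup>2"
    and s: "s \<in> S"
  shows "inner (x - y) s = 0"
proof (cases "s = 0")
  case False
  \<comment> \<open>This \<open>t\<close> minimises
    \<open>t\<^sup>2 * inner s s - 2 * t * inner (x - y) s\<close>, the change of the squared
    distance when \<open>y\<close> moves by \<open>t *\<^sub>R s\<close>.\<close>
  define t where "t = inner (x - y) s / inner s s"
  have ss: "inner s s > 0"
    using False by simp
  have "y + t *\<^sub>R s \<in> S"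
    using S y s by (simp add: subspace_add subspace_scale)
  then have "inner (x - y) (x - y) \<le> inner ((x - y) - t *\<^sub>R s) ((x - y) - t *\<^sub>R s)"
    using min[of "y + t *\<^sub>R s"] by (simp add: power2_norm_eq_inner diff_diff_eq)
  then have "0 \<le> t\<^sup>2 * inner s s - 2 * t * inner (x - y) s"
    by (simp add: inner_diff_left inner_diff_right inner_commute power2_eq_square algebra_simps)
  also have "\<dots> = - (inner (x - y) s)\<^sup>2 / inner s s"
    using ss by (simp add: t_def power2_eq_square field_simps)
  finally have "(inner (x - y) s)\<^sup>2 \<le> 0"
    using ss by (simp add: divide_le_0_iff zero_le_divide_iff)
  then show ?thesis
    by simp
qed simp

lemma orthogonal_projection_exists:
  fixes S :: "'b::{real_inner,complete_space} set"
  assumes S: "subspace S" and "closed S"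
  obtains y where "y \<in> S" "\<And>s. s \<in> S \<Longrightarrow> inner (x - y) s = 0"
proof -
  define d where "d = (INF s\<in>S. (norm (x - s))\<^sup>2)"
  have bdd: "bdd_below ((\<lambda>s. (norm (x - s))\<^sup>2) ` S)"
    by (rule bdd_belowI2[of _ 0]) simp
  have ne: "S \<noteq> {}"
    using S subspace_0 by blast
  have d_le: "d \<le> (norm (x - s))\<^sup>2" if "s \<in> S" for s
    unfolding d_def using bdd that by (rule cINF_lower)
  have "\<exists>s\<in>S. (norm (x - s))\<^sup>2 < d + inverse (real (Suc n))" for n
    using cINF_less_iff[OF ne bdd, of "d + inverse (real (Suc n))"] by (simp add: d_def)
  then obtain s where sS: "\<And>n. s n \<in> S"
    and sd: "\<And>n. (norm (x - s n))\<^sup>2 < d + inverse (real (Suc n))"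
    by metis
  \<comment> \<open>The parallelogram law at the midpoint of \<open>s m\<close> and \<open>s n\<close>, which lies in \<open>S\<close>.\<close>
  have near: "(norm (s m - s n))\<^sup>2 \<le> 2 * inverse (real (Suc m)) + 2 * inverse (real (Suc n))" for m n
  proof -
    have "(1/2) *\<^sub>R (s m + s n) \<in> S"
      using S sS by (simp add: subspace_add subspace_scale)
    then have "4 * d \<le> 4 * (norm (x - (1/2) *\<^sub>R (s m + s n)))\<^sup>2"
      using d_le by simp
    also have "\<dots> = 2 * (norm (x - s m))\<^sup>2 + 2 * (norm (x - s n))\<^sup>2 - (norm (s m - s n))\<^sup>2"
      by (simp add: power2_norm_eq_inner inner_diff_left inner_diff_right inner_add_left
          inner_add_right inner_commute algebra_simps)
    finally show ?thesis
      using sd[of m] sd[of n] by linarith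
  qed
  have "Cauchy s"
  proof (rule metric_CauchyI)
    fix e :: real assume e: "0 < e"
    \<comment> \<open>The quarter absorbs the coefficients 2 + 2 in \<open>near\<close>.\<close>
    then obtain N where N: "inverse (real (Suc N)) < e\<^sup>2 / 4"
      using reals_Archimedean[of "e\<^sup>2 / 4"] by auto
    have "dist (s m) (s n) < e" if "N \<le> m" "N \<le> n" for m n
    proof -
      have "inverse (real (Suc m)) \<le> inverse (real (Suc N))"
        "inverse (real (Suc n)) \<le> inverse (real (Suc N))"
        using that by (auto simp: le_imp_inverse_le)
      then have "(norm (s m - s n))\<^sup>2 < e\<^sup>2"
        using near[of m n] N by linarith
      then show ?thesis
        using e by (simp add: dist_norm power2_less_imp_less)
    qed
    then show "\<exists>N. \<forall>m\<ge>N. \<forall>n\<ge>N. dist (s m) (s n) < e"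
      by blast
  qed
  then obtain y where y: "s \<longlonglongrightarrow> y"
    using Cauchy_convergent_iff convergent_def by blast
  have yS: "y \<in> S"
    using \<open>closed S\<close> sS y closed_sequentially by blast
  have "(\<lambda>n. (norm (x - s n))\<^sup>2) \<longlonglongrightarrow> (norm (x - y))\<^sup>2"
    using y by (intro tendsto_intros)
  moreover have "(\<lambda>n. d + inverse (real (Suc n))) \<longlonglongrightarrow> d + 0"
    by (intro tendsto_intros LIMSEQ_inverse_real_of_nat)
  ultimately have "(norm (x - y))\<^sup>2 \<le> d + 0"
    by (rule LIMSEQ_le) (use sd less_imp_le in blast)
  then have "(norm (x - y))\<^sup>2 \<le> (norm (x - t))\<^sup>2" if "t \<in> S" for t
    using d_le[OF that] by linarith
  then show thesis
    using that yS nearest_point_orthogonal[OF S yS] by blast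
qed

lemma closure_eq_UNIV_if_orthogonal_trivial:
  fixes S :: "'b::{real_inner,complete_space} set"
  assumes S: "subspace S" and triv: "\<And>x. (\<And>s. s \<in> S \<Longrightarrow> inner x s = 0) \<Longrightarrow> x = 0"
  shows "closure S = UNIV"
proof -
  have "x \<in> closure S" for x
  proof -
    obtain y where "y \<in> closure S" "\<And>s. s \<in> closure S \<Longrightarrow> inner (x - y) s = 0"
      using orthogonal_projection_exists[OF subspace_closure[OF S] closed_closure] by blast
    then show ?thesis
      using triv[of "x - y"] closure_subset[of S] by auto
  qed
  then show ?thesis
    by blast
qed

text \<open>Stated for real functionals on a closed subspace because the product type that models
  \<open>H_plus A\<close> carries only a real inner product. The representing vector is a multiple
  of a vector orthogonal to the kernel.\<close>

lemma riesz_representation: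
  fixes S :: "'b::{real_inner,complete_space} set" and \<phi> :: "'b \<Rightarrow> real"
  assumes S: "subspace S" and "closed S"
    and add: "\<And>x y. x \<in> S \<Longrightarrow> y \<in> S \<Longrightarrow> \<phi> (x + y) = \<phi> x + \<phi> y"
    and scale: "\<And>c x. x \<in> S \<Longrightarrow> \<phi> (c *\<^sub>R x) = c * \<phi> x"
    and bound: "\<And>x. x \<in> S \<Longrightarrow> \<bar>\<phi> x\<bar> \<le> K * norm x"
  obtains w where "w \<in> S" "\<And>x. x \<in> S \<Longrightarrow> \<phi> x = inner w x"
proof -
  have zero: "\<phi> 0 = 0"
    using scale[of 0 0] S subspace_0 by auto
  have diff: "\<phi> (x - y) = \<phi> x - \<phi> y" if "x \<in> S" "y \<in> S" for x y
    using add[of "x - y" y] that S by (simp add: subspace_diff)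
  define N where "N = {x \<in> S. \<phi> x = 0}"
  have subN: "subspace N"
    unfolding N_def using S add scale zero
    by (intro subspaceI) (auto intro: subspace_0 subspace_add subspace_scale)
  have "closed N"
    unfolding closed_sequential_limits
  proof (intro allI impI)
    fix s l assume sl: "(\<forall>n. s n \<in> N) \<and> s \<longlonglongrightarrow> l"
    then have lS: "l \<in> S"
      using \<open>closed S\<close> closed_sequentially unfolding N_def by blast
    have "\<bar>\<phi> l\<bar> \<le> K * norm (l - s n)" for n
      using bound[of "l - s n"] diff[of l "s n"] sl lS S by (auto simp: N_def subspace_diff)
    moreover have "(\<lambda>n. K * norm (l - s n)) \<longlonglongrightarrow> K * norm (l - l)"
      using sl by (intro tendsto_intros) auto
    ultimately have "\<bar>\<phi> l\<bar> \<le> K * norm (l - l)"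
      by (intro LIMSEQ_le_const) auto
    then show "l \<in> N"
      using lS by (simp add: N_def)
  qed
  show thesis
  proof (cases "N = S")
    case True
    then show ?thesis
      using that[of 0] S subspace_0 by (auto simp: N_def)
  next
    case False
    then obtain x where x: "x \<in> S" "\<phi> x \<noteq> 0"
      unfolding N_def by blast
    obtain y where y: "y \<in> N" "\<And>s. s \<in> N \<Longrightarrow> inner (x - y) s = 0"
      using orthogonal_projection_exists[OF subN \<open>closed N\<close>] by blast
    define z where "z = x - y"
    have z: "z \<in> S" "\<phi> z \<noteq> 0"
      using x y S diff by (auto simp: z_def N_def subspace_diff)
    then have zz: "inner z z \<noteq> 0"
      using zero by auto
    have rep: "\<phi> t = inner ((\<phi> z / inner z z) *\<^sub>R z) t" if t: "t \<in> S" for t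
    proof -
      have "t - (\<phi> t / \<phi> z) *\<^sub>R z \<in> N"
        using t z S by (simp add: N_def diff scale subspace_diff subspace_scale)
      then have "inner z (t - (\<phi> t / \<phi> z) *\<^sub>R z) = 0"
        using y by (simp add: z_def)
      then show ?thesis
        using z zz by (simp add: inner_diff_right field_simps)
    qed
    show ?thesis
      using that[OF _ rep] z S by (simp add: subspace_scale)
  qed
qed

section \<open>Complex inner products and linear relations\<close>

lemma cinner_add_right: "cinner x (y + z) = cinner x y + cinner x z"
  by (metis cinner_add_left cinner_commute complex_cnj_add)

lemma cinner_scaleC_right: "cinner x (c *\<^sub>C y) = cnj c * cinner x y"
  by (metis cinner_commute cinner_scaleC_left complex_cnj_mult)

lemma cinner_zero_left [simp]: "cinner 0 y = 0"
  using cinner_add_left[of 0 0 y] by simp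

lemma cinner_zero_right [simp]: "cinner x 0 = 0"
  using cinner_add_right[of x 0 0] by simp

lemma cinner_minus_left: "cinner (- x) y = - cinner x y"
  using cinner_add_left[of x "- x" y] by (simp add: eq_neg_iff_add_eq_0 add.commute)

lemma cinner_minus_right: "cinner x (- y) = - cinner x y"
  using cinner_add_right[of x y "- y"] by (simp add: eq_neg_iff_add_eq_0 add.commute)

lemma cinner_diff_left: "cinner (x - y) z = cinner x z - cinner y z"
  using cinner_add_left[of x "- y" z] by (simp add: cinner_minus_left)

lemma cinner_diff_right: "cinner x (y - z) = cinner x y - cinner x z"
  using cinner_add_right[of x y "- z"] by (simp add: cinner_minus_right)

lemmas cinner_simps = cinner_add_left cinner_add_right cinner_diff_left cinner_diff_right
  cinner_minus_left cinner_minus_right cinner_scaleC_left cinner_scaleC_right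

lemma cinner_eq_Complex: "cinner x y = Complex (inner x y) (inner x (\<i> *\<^sub>C y))"
  by (rule complex_eqI) (simp_all add: inner_eq_Re_cinner cinner_scaleC_right)

lemma cinner_self: "cinner x x = complex_of_real ((norm x)\<^sup>2)"
proof (rule complex_eqI)
  show "Im (cinner x x) = Im (complex_of_real ((norm x)\<^sup>2))"
    using arg_cong[OF cinner_commute[of x x], of Im] by simp
qed (simp add: power2_norm_eq_inner inner_eq_Re_cinner)

lemma cinner_eq_zeroD: "cinner x x = 0 \<Longrightarrow> x = 0"
  by (simp add: cinner_self)

lemma cinner_ext:
  assumes "\<And>g. cinner x g = cinner y g"
  shows "x = y"
proof -
  have "cinner (x - y) (x - y) = 0"
    using assms by (simp add: cinner_diff_left)
  then show ?thesis
    using cinner_eq_zeroD by force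
qed

lemma norm_scaleC: "norm (c *\<^sub>C x) = cmod c * norm x"
proof -
  have "complex_of_real ((norm (c *\<^sub>C x))\<^sup>2) = c * cnj c * cinner x x"
    unfolding cinner_self[symmetric] by (simp add: cinner_simps)
  also have "\<dots> = complex_of_real ((cmod c * norm x)\<^sup>2)"
    by (simp only: cinner_self power_mult_distrib of_real_mult complex_norm_square)
  finally have "(norm (c *\<^sub>C x))\<^sup>2 = (cmod c * norm x)\<^sup>2"
    by (simp only: of_real_eq_iff)
  then show ?thesis
    by (simp add: power2_eq_iff_nonneg)
qed

lemma complex_unimodular_rotation:
  obtains c where "cmod c = 1" "c * z = complex_of_real (cmod z)"
proof (cases "z = 0")
  case True
  then show ?thesis
    using that[of 1] by simp
next
  case False
  have "(cnj z / cmod z) * z = complex_of_real (cmod z)"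
    using False by (simp add: complex_norm_square[symmetric] power2_eq_square field_simps
        mult.commute[of "cnj z"])
  then show ?thesis
    using that[of "cnj z / cmod z"] False by (simp add: norm_divide)
qed

lemma norm_cinner_le: "cmod (cinner x y) \<le> norm x * norm y"
proof -
  obtain c where c: "cmod c = 1" "c * cinner x y = complex_of_real (cmod (cinner x y))"
    using complex_unimodular_rotation .
  then have "cmod (cinner x y) = inner (c *\<^sub>C x) y"
    by (simp add: inner_eq_Re_cinner cinner_scaleC_left)
  also have "\<dots> \<le> norm (c *\<^sub>C x) * norm y"
    by (rule norm_cauchy_schwarz)
  finally show ?thesis
    using c by (simp add: norm_scaleC)
qed

lemma tendsto_cinner_left: "(s \<longlongrightarrow> l) F \<Longrightarrow> ((\<lambda>n. cinner (s n) y) \<longlongrightarrow> cinner l y) F"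
  unfolding cinner_eq_Complex by (intro tendsto_intros)

lemma continuous_on_cinner_left [continuous_intros]:
  "continuous_on S s \<Longrightarrow> continuous_on S (\<lambda>n. cinner (s n) y)"
  unfolding continuous_on by (blast intro: tendsto_cinner_left)

lemma linear_relation_add:
  "linear_relation T \<Longrightarrow> (f, f') \<in> T \<Longrightarrow> (g, g') \<in> T \<Longrightarrow> (f + g, f' + g') \<in> T"
  unfolding linear_relation_def by force

lemma linear_relation_scale:
  "linear_relation T \<Longrightarrow> (f, f') \<in> T \<Longrightarrow> (c *\<^sub>C f, c *\<^sub>C f') \<in> T"
  unfolding linear_relation_def scale_rel_def by force

lemma scaleC_minus_one: "(-1) *\<^sub>C x = - x"
  using scaleR_scaleC[of "-1" x] by simp

lemma linear_relation_diff:
  assumes "linear_relation T" "(f, f') \<in> T" "(g, g') \<in> T"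
  shows "(f - g, f' - g') \<in> T"
  using linear_relation_add[OF assms(1,2) linear_relation_scale[OF assms(1,3), of "-1"]]
  by (simp add: scaleC_minus_one)

lemma linear_relation_zero: "linear_relation T \<Longrightarrow> (0, 0) \<in> T"
  unfolding linear_relation_def by (simp add: zero_prod_def)

lemma subspace_linear_relation: "linear_relation T \<Longrightarrow> subspace T"
  unfolding linear_relation_def scale_rel_def
  by (intro subspaceI) (auto simp: scaleR_scaleC scaleR_prod_def)

lemma adjoint_rel_iff:
  "(u, f) \<in> adjoint_rel T \<longleftrightarrow> (\<forall>v g. (v, g) \<in> T \<longrightarrow> cinner f v = cinner u g)"
  unfolding adjoint_rel_def by auto

lemma linear_relation_adjoint: "linear_relation (adjoint_rel T)"
  unfolding linear_relation_def scale_rel_def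
  by (auto simp: adjoint_rel_iff zero_prod_def cinner_simps)

lemma closed_adjoint_rel: "closed (adjoint_rel T)"
proof -
  have "adjoint_rel T = (\<Inter>x\<in>T. {y. cinner (snd y) (fst x) = cinner (fst y) (snd x)})"
    unfolding adjoint_rel_def by (auto simp: case_prod_beta) (metis fst_conv snd_conv)
  also have "closed \<dots>"
    by (intro closed_INT ballI closed_Collect_eq continuous_intros)
  finally show ?thesis .
qed

lemma adjoint_rel_antimono: "S \<subseteq> T \<Longrightarrow> adjoint_rel T \<subseteq> adjoint_rel S"
  unfolding adjoint_rel_def by auto

section \<open>Selfadjoint relations\<close>

locale selfadjoint_relation =
  fixes B :: "('a::complex_hilbert_space \<times> 'a) set"
  assumes adjoint_eq: "adjoint_rel B = B"
begin

lemma linear: "linear_relation B"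
  using linear_relation_adjoint[of B] by (simp add: adjoint_eq)

lemma symmetric: "(f, f') \<in> B \<Longrightarrow> (g, g') \<in> B \<Longrightarrow> cinner f' g = cinner f g'"
  using adjoint_rel_iff[of f f' B] by (simp add: adjoint_eq)

lemma memI: "(\<And>k k'. (k, k') \<in> B \<Longrightarrow> cinner f' k = cinner f k') \<Longrightarrow> (f, f') \<in> B"
  using adjoint_rel_iff[of f f' B] by (simp add: adjoint_eq)

text \<open>The cross terms are \<open>cnj z\<close> and \<open>z\<close> times the same number, by
  symmetry, and cancel because \<open>z\<close> is purely imaginary. Uniqueness and contractivity of
  the resolvent both rest on this identity.\<close>

lemma norm_diff_imaginary:
  assumes f: "(f, f') \<in> B" and z: "z = \<i> \<or> z = - \<i>"
  shows "(norm (f' - z *\<^sub>C f))\<^sup>2 = (norm f')\<^sup>2 + (norm f)\<^sup>2"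
proof -
  have "cinner (f' - z *\<^sub>C f) (f' - z *\<^sub>C f) = cinner f' f' + cinner f f"
    using symmetric[OF f f] z by (auto simp: cinner_simps algebra_simps)
  then have "complex_of_real ((norm (f' - z *\<^sub>C f))\<^sup>2) = complex_of_real ((norm f')\<^sup>2 + (norm f)\<^sup>2)"
    by (simp only: cinner_self of_real_add)
  then show ?thesis
    by (simp only: of_real_eq_iff)
qed

text \<open>Decompose \<open>(0, h) = (f, f') + (r, s)\<close> with \<open>(f, f') \<in> B\<close> and \<open>(r, s)\<close> orthogonal to \<open>B\<close>;
  the latter means \<open>(s, - r) \<in> B\<close>.\<close>

lemma resolvent_exists:
  assumes z: "z = \<i> \<or> z = - \<i>"
  shows "\<exists>f f'. (f, f') \<in> B \<and> f' - z *\<^sub>C f = h"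
proof -
  obtain y where y: "y \<in> B" and orth: "\<And>x. x \<in> B \<Longrightarrow> inner ((0, h) - y) x = 0"
    using orthogonal_projection_exists[OF subspace_linear_relation[OF linear]]
      closed_adjoint_rel[of B] by (metis adjoint_eq)
  obtain f f' where f: "y = (f, f')"
    by (cases y)
  define s where "s = h - f'"
  have perp: "inner s k' = inner f k" if "(k, k') \<in> B" for k k'
    using orth[OF that] f by (simp add: s_def)
  have "(s, f) \<in> B"
  proof (rule memI)
    fix k k' assume k: "(k, k') \<in> B"
    \<comment> \<open>Orthogonality is real; testing with the pair multiplied by \<open>\<i>\<close>
      supplies the imaginary part.\<close>
    from perp[OF k] perp[OF linear_relation_scale[OF linear k, of \<i>]]
    show "cinner f k = cinner s k'"
      by (simp add: cinner_eq_Complex)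
  qed
  \<comment> \<open>Adding \<open>z\<close> times \<open>(s, f)\<close> works because
    \<open>z * z = - 1\<close>: the terms \<open>z *\<^sub>C f\<close> cancel and
    \<open>s = h - f'\<close> remains.\<close>
  then have "(f + z *\<^sub>C s, f' + z *\<^sub>C f) \<in> B"
    using y f by (simp add: linear linear_relation_add linear_relation_scale)
  moreover have "f' + z *\<^sub>C f - z *\<^sub>C (f + z *\<^sub>C s) = h"
    using z by (auto simp: s_def scaleC_add_right scaleC_scaleC scaleC_minus_one)
  ultimately show ?thesis
    by blast
qed

lemma resolvent_eq:
  assumes f: "(f, f') \<in> B" and z: "z = \<i> \<or> z = - \<i>" and h: "f' - z *\<^sub>C f = h"
  shows "resolvent_rel B z h = f"
  unfolding resolvent_rel_def
proof (rule the_equality)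
  show "\<exists>f'. (f, f') \<in> B \<and> f' - z *\<^sub>C f = h"
    using f h by blast
next
  fix g assume "\<exists>g'. (g, g') \<in> B \<and> g' - z *\<^sub>C g = h"
  then obtain g' where g: "(g, g') \<in> B" "g' - z *\<^sub>C g = h"
    by blast
  have "(g' - f') - z *\<^sub>C (g - f) = 0"
    using g(2) h by (simp add: complex_vector.scale_right_diff_distrib algebra_simps)
  then show "g = f"
    using norm_diff_imaginary[OF linear_relation_diff[OF linear g(1) f] z]
    by (simp add: sum_power2_eq_zero_iff)
qed

lemma resolvent_mem:
  assumes z: "z = \<i> \<or> z = - \<i>"
  shows "(resolvent_rel B z h, h + z *\<^sub>C resolvent_rel B z h) \<in> B"
proof -
  obtain f f' where f: "(f, f') \<in> B" "f' - z *\<^sub>C f = h"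
    using resolvent_exists[OF z] by blast
  then have "resolvent_rel B z h = f"
    using resolvent_eq z by blast
  then show ?thesis
    using f by (auto simp: algebra_simps)
qed

lemma resolvent_bounds:
  assumes z: "z = \<i> \<or> z = - \<i>"
  shows "norm (resolvent_rel B z h) \<le> norm h"
    and "norm (h + z *\<^sub>C resolvent_rel B z h) \<le> norm h"
  using norm_diff_imaginary[OF resolvent_mem[OF z, of h] z] by (auto intro: power2_le_imp_le)

lemma resolvent_add:
  assumes z: "z = \<i> \<or> z = - \<i>"
  shows "resolvent_rel B z (g + h) = resolvent_rel B z g + resolvent_rel B z h"
  by (rule resolvent_eq[OF linear_relation_add[OF linear resolvent_mem[OF z, of g]
          resolvent_mem[OF z, of h]] z])
    (simp add: scaleC_add_right algebra_simps)

lemma resolvent_scaleC: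
  assumes z: "z = \<i> \<or> z = - \<i>"
  shows "resolvent_rel B z (c *\<^sub>C h) = c *\<^sub>C resolvent_rel B z h"
  by (rule resolvent_eq[OF linear_relation_scale[OF linear resolvent_mem[OF z, of h]] z])
    (simp add: scaleC_add_right scaleC_scaleC mult.commute algebra_simps)

end

section \<open>The rigging\<close>

lemma tendsto_scaleC:
  assumes "(s \<longlongrightarrow> l) F"
  shows "((\<lambda>n. c *\<^sub>C s n) \<longlongrightarrow> c *\<^sub>C l) F"
proof -
  have "((\<lambda>n. norm (s n - l)) \<longlongrightarrow> 0) F"
    using assms by (simp add: LIM_zero tendsto_norm_zero)
  then have "((\<lambda>n. cmod c * norm (s n - l)) \<longlongrightarrow> 0) F"
    by (rule tendsto_mult_right_zero)
  then have "((\<lambda>n. c *\<^sub>C s n - c *\<^sub>C l) \<longlongrightarrow> 0) F"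
    by (simp add: tendsto_norm_zero_iff flip: norm_scaleC complex_vector.scale_right_diff_distrib)
  then show ?thesis
    by (rule LIM_zero_cancel)
qed

lemma subspace_of_csubspace:
  "complex_vector.subspace S \<Longrightarrow> subspace S"
  by (intro subspaceI) (simp_all add: complex_vector.subspace_0 complex_vector.subspace_add
      complex_vector.subspace_scale scaleR_scaleC)

lemma csubspace_closure:
  assumes S: "complex_vector.subspace S"
  shows "complex_vector.subspace (closure S)"
proof (rule complex_vector.subspaceI)
  have "subspace (closure S)"
    by (intro subspace_closure subspace_of_csubspace S)
  then show "0 \<in> closure S" "\<And>x y. x \<in> closure S \<Longrightarrow> y \<in> closure S \<Longrightarrow> x + y \<in> closure S"
    by (auto simp: subspace_0 subspace_add)
next
  fix x c assume "x \<in> closure S"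
  then obtain s where "\<forall>n. s n \<in> S" "s \<longlonglongrightarrow> x"
    unfolding closure_sequential by blast
  then have "\<forall>n. c *\<^sub>C s n \<in> S" "(\<lambda>n. c *\<^sub>C s n) \<longlonglongrightarrow> c *\<^sub>C x"
    using S by (auto intro: complex_vector.subspace_scale tendsto_scaleC)
  then show "c *\<^sub>C x \<in> closure S"
    unfolding closure_sequential by (intro exI conjI)
qed

lemma orth_proj_eqI:
  assumes S: "complex_vector.subspace S" and y: "y \<in> S" "\<And>s. s \<in> S \<Longrightarrow> cinner (x - y) s = 0"
  shows "orth_proj S x = y"
  unfolding orth_proj_def
proof (rule the_equality)
  fix t assume t: "t \<in> S \<and> (\<forall>s\<in>S. cinner (x - t) s = 0)"
  then have "t - y \<in> S"
    using S y by (simp add: complex_vector.subspace_diff)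
  then have "cinner (x - y) (t - y) - cinner (x - t) (t - y) = 0"
    using t y by simp
  then have "cinner (t - y) (t - y) = 0"
    by (simp add: cinner_simps algebra_simps)
  then show "t = y"
    using cinner_eq_zeroD by force
qed (use y in auto)

text \<open>The real projection is already the complex one: \<open>S\<close> is invariant under
  \<open>\<i>\<close>, so real orthogonality to \<open>S\<close> is complex orthogonality.\<close>

lemma orth_proj:
  assumes S: "complex_vector.subspace S" and "closed S"
  shows "orth_proj S x \<in> S" and "s \<in> S \<Longrightarrow> cinner (x - orth_proj S x) s = 0"
proof -
  obtain y where y: "y \<in> S" "\<And>s. s \<in> S \<Longrightarrow> inner (x - y) s = 0"
    using orthogonal_projection_exists[OF subspace_of_csubspace[OF S] \<open>closed S\<close>] by blast
  have orth: "cinner (x - y) s = 0" if "s \<in> S" for s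
    using y(2) that complex_vector.subspace_scale[OF S that, of \<i>]
    by (simp add: cinner_eq_Complex Complex_eq_0)
  show "orth_proj S x \<in> S" "s \<in> S \<Longrightarrow> cinner (x - orth_proj S x) s = 0"
    using orth_proj_eqI[OF S y(1) orth] y(1) orth by simp_all
qed

lemma csubspace_Domain:
  assumes T: "linear_relation T"
  shows "complex_vector.subspace (Domain T)"
  using linear_relation_zero[OF T] linear_relation_add[OF T] linear_relation_scale[OF T]
  by (intro complex_vector.subspaceI) blast+

lemma csubspace_mul_rel:
  assumes T: "linear_relation T"
  shows "complex_vector.subspace (mul_rel T)"
  using linear_relation_zero[OF T] linear_relation_add[OF T, of 0 _ 0]
    linear_relation_scale[OF T, of 0]
  by (intro complex_vector.subspaceI) (auto simp: mul_rel_def)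

lemma cinner_closure_zero:
  assumes "\<And>s. s \<in> S \<Longrightarrow> cinner x s = 0" and "s \<in> closure S"
  shows "cinner x s = 0"
proof -
  have "closed {t. cinner t x = 0}"
    by (intro closed_Collect_eq continuous_intros)
  moreover have "S \<subseteq> {t. cinner t x = 0}"
    using assms(1) by (metis (mono_tags) cinner_commute complex_cnj_zero mem_Collect_eq subsetI)
  ultimately have "cinner s x = 0"
    using assms(2) closure_minimal by blast
  then show ?thesis
    by (metis cinner_commute complex_cnj_zero)
qed

text \<open>\<open>\<HH>\<^sub>+\<close> is isometric to a closed subspace of \<open>\<HH>\<^sup>3\<close>: the vector \<open>h\<^sub>0 + h\<^sub>1\<close> corresponds to
  \<open>(h\<^sub>0, P h\<^sub>0', h\<^sub>1)\<close>.\<close>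

definition rigging_model ::
    "('a::complex_hilbert_space \<times> 'a) set \<Rightarrow> ('a \<times> 'a \<times> 'a) set" where
  "rigging_model A =
     {(h\<^sub>0, k, h\<^sub>1). (h\<^sub>0, k) \<in> adjoint_rel A \<and> k \<in> closure (Domain A) \<and> h\<^sub>1 \<in> mul_rel A}"

locale closed_relation =
  fixes A :: "('a::complex_hilbert_space \<times> 'a) set"
  assumes linear: "linear_relation A" and closed: "closed A"
begin

abbreviation P :: "'a \<Rightarrow> 'a" where
  "P \<equiv> orth_proj (closure (Domain A))"

lemma csubspace_H0: "complex_vector.subspace (closure (Domain A))"
  by (intro csubspace_closure csubspace_Domain linear)

lemmas P_in = orth_proj(1)[OF csubspace_H0 closed_closure]
lemmas P_orth = orth_proj(2)[OF csubspace_H0 closed_closure]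

lemma adjoint_orth_mul:
  "(h\<^sub>0, h\<^sub>0') \<in> adjoint_rel A \<Longrightarrow> h\<^sub>1 \<in> mul_rel A \<Longrightarrow> cinner h\<^sub>0 h\<^sub>1 = 0"
  unfolding adjoint_rel_iff mul_rel_def by force

lemma mul_adjoint_orth:
  assumes "(0, k) \<in> adjoint_rel A" "s \<in> closure (Domain A)"
  shows "cinner k s = 0"
  by (rule cinner_closure_zero[OF _ assms(2)]) (use assms(1) in \<open>force simp: adjoint_rel_iff\<close>)

text \<open>The adjoint condition tests \<open>h'\<close> only against the domain of
  \<open>A\<close>, so the part of \<open>h'\<close> orthogonal to it may be dropped.\<close>

lemma adjoint_P:
  assumes "(h, h') \<in> adjoint_rel A"
  shows "(h, P h') \<in> adjoint_rel A"
  unfolding adjoint_rel_iff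
proof (intro allI impI)
  fix v g assume v: "(v, g) \<in> A"
  then have "v \<in> closure (Domain A)"
    using closure_subset by blast
  then have "cinner (h' - P h') v = 0"
    by (rule P_orth)
  then show "cinner (P h') v = cinner h g"
    using assms v by (simp add: adjoint_rel_iff cinner_diff_left)
qed

lemma P_fixed: "k \<in> closure (Domain A) \<Longrightarrow> P k = k"
  by (rule orth_proj_eqI[OF csubspace_H0]) auto

text \<open>The difference of the first summands lies both in the domain of the adjoint and in
  \<open>mul_rel A\<close>, which are orthogonal. After that, the difference of the projections lies
  in the multivalued part of the adjoint, orthogonal to \<open>closure (Domain A)\<close>, and also
  in this closure.\<close>

lemma rigging_decomposition_unique:
  assumes h: "(h\<^sub>0, h\<^sub>0') \<in> adjoint_rel A" "h\<^sub>1 \<in> mul_rel A"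
    and l: "(l\<^sub>0, l\<^sub>0') \<in> adjoint_rel A" "l\<^sub>1 \<in> mul_rel A"
    and eq: "h\<^sub>0 + h\<^sub>1 = l\<^sub>0 + l\<^sub>1"
  shows "h\<^sub>0 = l\<^sub>0" and "h\<^sub>1 = l\<^sub>1" and "P h\<^sub>0' = P l\<^sub>0'"
proof -
  have d: "(h\<^sub>0 - l\<^sub>0, P h\<^sub>0' - P l\<^sub>0') \<in> adjoint_rel A"
    by (intro linear_relation_diff linear_relation_adjoint adjoint_P h l)
  have "h\<^sub>0 - l\<^sub>0 = l\<^sub>1 - h\<^sub>1"
    using eq by (simp add: algebra_simps)
  moreover have "l\<^sub>1 - h\<^sub>1 \<in> mul_rel A"
    using h l by (intro complex_vector.subspace_diff csubspace_mul_rel linear)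
  ultimately have "cinner (h\<^sub>0 - l\<^sub>0) (h\<^sub>0 - l\<^sub>0) = 0"
    using adjoint_orth_mul[OF d] by metis
  then show 0: "h\<^sub>0 = l\<^sub>0"
    using cinner_eq_zeroD by force
  then show "h\<^sub>1 = l\<^sub>1"
    using eq by simp
  have "P h\<^sub>0' - P l\<^sub>0' \<in> closure (Domain A)"
    by (intro complex_vector.subspace_diff csubspace_H0 P_in)
  then have "cinner (P h\<^sub>0' - P l\<^sub>0') (P h\<^sub>0' - P l\<^sub>0') = 0"
    using d 0 by (intro mul_adjoint_orth) simp_all
  then show "P h\<^sub>0' = P l\<^sub>0'"
    using cinner_eq_zeroD by force
qed

lemma norm_plus_eq:
  assumes "(h\<^sub>0, h\<^sub>0') \<in> adjoint_rel A" "h\<^sub>1 \<in> mul_rel A"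
  shows "norm_plus A (h\<^sub>0 + h\<^sub>1) = sqrt ((norm h\<^sub>0)\<^sup>2 + (norm (P h\<^sub>0'))\<^sup>2 + (norm h\<^sub>1)\<^sup>2)"
  unfolding norm_plus_def
proof (rule the_equality)
  fix r assume "\<exists>l\<^sub>0 l\<^sub>0' l\<^sub>1. (l\<^sub>0, l\<^sub>0') \<in> adjoint_rel A \<and> l\<^sub>1 \<in> mul_rel A \<and> h\<^sub>0 + h\<^sub>1 = l\<^sub>0 + l\<^sub>1 \<and>
    r = sqrt ((norm l\<^sub>0)\<^sup>2 + (norm (P l\<^sub>0'))\<^sup>2 + (norm l\<^sub>1)\<^sup>2)"
  then show "r = sqrt ((norm h\<^sub>0)\<^sup>2 + (norm (P h\<^sub>0'))\<^sup>2 + (norm h\<^sub>1)\<^sup>2)"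
    using rigging_decomposition_unique[OF assms] by metis
qed (use assms in blast)

lemma csubspace_H_plus: "complex_vector.subspace (H_plus A)"
proof -
  have "H_plus A = {x + y |x y. x \<in> Domain (adjoint_rel A) \<and> y \<in> mul_rel A}"
    by (simp add: H_plus_def)
  then show ?thesis
    by (simp add: complex_vector.subspace_sums csubspace_Domain linear_relation_adjoint
        csubspace_mul_rel linear)
qed

lemma adjoint_in_H_plus: "(h, h') \<in> adjoint_rel A \<Longrightarrow> h \<in> H_plus A"
  unfolding H_plus_def
  using complex_vector.subspace_0[OF csubspace_mul_rel[OF linear]] by force

lemma H_plus_model:
  assumes "h \<in> H_plus A"
  obtains h\<^sub>0 k h\<^sub>1 where "(h\<^sub>0, k, h\<^sub>1) \<in> rigging_model A" "h = h\<^sub>0 + h\<^sub>1"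
proof -
  obtain h\<^sub>0 h\<^sub>0' h\<^sub>1 where "(h\<^sub>0, h\<^sub>0') \<in> adjoint_rel A" "h\<^sub>1 \<in> mul_rel A" "h = h\<^sub>0 + h\<^sub>1"
    using assms unfolding H_plus_def by blast
  then show thesis
    using that[of h\<^sub>0 "P h\<^sub>0'" h\<^sub>1] adjoint_P P_in by (simp add: rigging_model_def)
qed

lemma model_in_H_plus: "(h\<^sub>0, k, h\<^sub>1) \<in> rigging_model A \<Longrightarrow> h\<^sub>0 + h\<^sub>1 \<in> H_plus A"
  unfolding rigging_model_def H_plus_def by blast

lemma model_norm:
  assumes "(h\<^sub>0, k, h\<^sub>1) \<in> rigging_model A"
  shows "norm (h\<^sub>0, k, h\<^sub>1) = norm_plus A (h\<^sub>0 + h\<^sub>1)"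
  using assms norm_plus_eq[of h\<^sub>0 k h\<^sub>1]
  by (simp add: rigging_model_def norm_Pair P_fixed add.assoc)

lemma norm_plus_nonneg: "h \<in> H_plus A \<Longrightarrow> 0 \<le> norm_plus A h"
  by (metis H_plus_model model_norm norm_ge_zero)

lemma norm_le_norm_plus:
  assumes "h \<in> H_plus A"
  shows "norm h \<le> norm_plus A h"
proof -
  obtain h\<^sub>0 k h\<^sub>1 where h: "(h\<^sub>0, k, h\<^sub>1) \<in> rigging_model A" "h = h\<^sub>0 + h\<^sub>1"
    using H_plus_model[OF assms] .
  then have "cinner h\<^sub>0 h\<^sub>1 = 0"
    using adjoint_orth_mul by (auto simp: rigging_model_def)
  then have "(norm h)\<^sup>2 = (norm h\<^sub>0)\<^sup>2 + (norm h\<^sub>1)\<^sup>2"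
    by (simp add: h power2_norm_eq_inner inner_add_left inner_add_right inner_commute
        inner_eq_Re_cinner[of h\<^sub>0 h\<^sub>1])
  also have "\<dots> \<le> (norm (h\<^sub>0, k, h\<^sub>1))\<^sup>2"
    by (simp add: norm_Pair)
  finally show ?thesis
    using model_norm[OF h(1)] h(2) norm_plus_nonneg[OF assms]
    by (metis power2_le_imp_le)
qed

text \<open>Uses the full \<open>h'\<close> instead of its projection, so bounds on a resolvent and
  on its image give boundedness into \<open>H_plus A\<close>.\<close>

lemma norm_plus_adjoint_le:
  assumes "(h, h') \<in> adjoint_rel A"
  shows "norm_plus A h \<le> norm h + norm h'"
proof -
  have "cinner (h' - P h') (P h') = 0"
    using P_orth P_in by blast
  then have "(norm h')\<^sup>2 = (norm (P h'))\<^sup>2 + (norm (h' - P h'))\<^sup>2"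
    using inner_eq_Re_cinner[of "h' - P h'" "P h'"]
    by (simp add: power2_norm_eq_inner inner_diff_left inner_diff_right inner_commute)
  then have "norm (P h') \<le> norm h'"
    by (auto intro: power2_le_imp_le)
  moreover have "norm_plus A h \<le> norm h + norm (P h')"
    using norm_plus_eq[OF assms complex_vector.subspace_0[OF csubspace_mul_rel[OF linear]]]
    by (simp add: sqrt_sum_squares_le_sum)
  ultimately show ?thesis
    by simp
qed

lemma linear_model:
  assumes "(x\<^sub>0, k, x\<^sub>1) \<in> rigging_model A" "(y\<^sub>0, l, y\<^sub>1) \<in> rigging_model A"
  shows "(x\<^sub>0 + y\<^sub>0, k + l, x\<^sub>1 + y\<^sub>1) \<in> rigging_model A"
    and "(c *\<^sub>C x\<^sub>0, c *\<^sub>C k, c *\<^sub>C x\<^sub>1) \<in> rigging_model A"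
  using assms
  by (auto simp: rigging_model_def linear_relation_add linear_relation_scale
      linear_relation_adjoint complex_vector.subspace_add complex_vector.subspace_scale
      csubspace_H0 csubspace_mul_rel linear)

lemma subspace_model: "subspace (rigging_model A)"
proof (rule subspaceI)
  show "0 \<in> rigging_model A"
    by (simp add: rigging_model_def zero_prod_def linear_relation_zero linear_relation_adjoint
        complex_vector.subspace_0 csubspace_H0 csubspace_mul_rel linear)
qed (auto simp: linear_model scaleR_prod_def scaleR_scaleC)

text \<open>This is completeness of \<open>H_plus A\<close> in disguise. \<open>mul_rel A\<close> is
  the section of the closed set \<open>A\<close> over 0.\<close>

lemma closed_model: "closed (rigging_model A)"
proof -
  have "rigging_model A = (\<lambda>x. (fst x, fst (snd x))) -` adjoint_rel A
    \<inter> (\<lambda>x. fst (snd x)) -` closure (Domain A) \<inter> (\<lambda>x. (0, snd (snd x))) -` A"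
    by (auto simp: rigging_model_def mul_rel_def)
  also have "closed \<dots>"
    by (intro closed_Int continuous_closed_vimage closed closed_adjoint_rel closed_closure
        continuous_intros)
  finally show ?thesis .
qed

section \<open>Functionals on \<open>H_plus A\<close> and the density of the Hilbert space among
  them\<close>

lemma H_minus_add: "\<phi> \<in> H_minus A \<Longrightarrow> h \<in> H_plus A \<Longrightarrow> k \<in> H_plus A \<Longrightarrow> \<phi> (h + k) = \<phi> h + \<phi> k"
  and H_minus_scaleC: "\<phi> \<in> H_minus A \<Longrightarrow> h \<in> H_plus A \<Longrightarrow> \<phi> (c *\<^sub>C h) = cnj c * \<phi> h"
  unfolding H_minus_def by blast+

lemma H_minus_bound:
  assumes "\<phi> \<in> H_minus A"
  obtains K where "0 \<le> K" "\<And>h. h \<in> H_plus A \<Longrightarrow> cmod (\<phi> h) \<le> K * norm_plus A h"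
proof -
  obtain K where K: "\<And>h. h \<in> H_plus A \<Longrightarrow> cmod (\<phi> h) \<le> K * norm_plus A h"
    using assms unfolding H_minus_def by blast
  have "cmod (\<phi> h) \<le> \<bar>K\<bar> * norm_plus A h" if "h \<in> H_plus A" for h
    using K[OF that] mult_right_mono[OF abs_ge_self norm_plus_nonneg[OF that]] order_trans
    by blast
  then show thesis
    using that[of "\<bar>K\<bar>"] by simp
qed

lemma embed_minus_apply: "h \<in> H_plus A \<Longrightarrow> embed_minus A f h = cinner f h"
  by (simp add: embed_minus_def)

lemma embed_minus_add: "embed_minus A (u + v) = embed_minus A u + embed_minus A v"
  by (rule ext) (simp add: embed_minus_def cinner_add_left)

lemma embed_minus_in_H_minus: "embed_minus A f \<in> H_minus A"
proof -
  have "cmod (cinner f h) \<le> norm f * norm_plus A h" if "h \<in> H_plus A" for h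
    using norm_cinner_le[of f h] mult_left_mono[OF norm_le_norm_plus[OF that], of "norm f"]
    by simp
  then show ?thesis
    unfolding H_minus_def
    by (auto simp: embed_minus_def cinner_simps complex_vector.subspace_add[OF csubspace_H_plus]
        complex_vector.subspace_scale[OF csubspace_H_plus])
qed

lemma H_minus_plus:
  assumes "\<phi> \<in> H_minus A" "\<psi> \<in> H_minus A"
  shows "\<phi> + \<psi> \<in> H_minus A"
proof -
  obtain K L where "\<And>h. h \<in> H_plus A \<Longrightarrow> cmod (\<phi> h) \<le> K * norm_plus A h"
    "\<And>h. h \<in> H_plus A \<Longrightarrow> cmod (\<psi> h) \<le> L * norm_plus A h"
    using H_minus_bound assms by metis
  then have "cmod (\<phi> h + \<psi> h) \<le> (K + L) * norm_plus A h" if "h \<in> H_plus A" for h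
    using that norm_triangle_ineq[of "\<phi> h" "\<psi> h"] by (fastforce simp: distrib_right)
  then have "\<exists>M. \<forall>h\<in>H_plus A. cmod (\<phi> h + \<psi> h) \<le> M * norm_plus A h"
    by blast
  then show ?thesis
    using assms by (simp add: H_minus_def distrib_left add_ac)
qed

lemma H_minus_uminus: "\<phi> \<in> H_minus A \<Longrightarrow> - \<phi> \<in> H_minus A"
  unfolding H_minus_def by auto

lemma norm_minus_le:
  assumes "\<And>h. h \<in> H_plus A \<Longrightarrow> cmod (\<phi> h) \<le> e * norm_plus A h" and e: "0 \<le> e"
  shows "norm_minus A \<phi> \<le> e"
  unfolding norm_minus_def
proof (rule cSUP_least)
  have "norm_plus A 0 = 0"
    using norm_plus_eq[OF linear_relation_zero[OF linear_relation_adjoint]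
        complex_vector.subspace_0[OF csubspace_mul_rel[OF linear]]]
      P_fixed[OF complex_vector.subspace_0[OF csubspace_H0]] by simp
  then show "{h \<in> H_plus A. norm_plus A h \<le> 1} \<noteq> {}"
    using complex_vector.subspace_0[OF csubspace_H_plus] by force
next
  fix h assume "h \<in> {h \<in> H_plus A. norm_plus A h \<le> 1}"
  then show "cmod (\<phi> h) \<le> e"
    using assms(1)[of h] mult_left_mono[of "norm_plus A h" 1 e] e by simp
qed

text \<open>A real supremum is informative only over a set bounded above, hence the membership of
  \<open>\<phi>\<close>; the lower bound comes from the vector 0.\<close>

lemma norm_minus_nonneg:
  assumes \<phi>: "\<phi> \<in> H_minus A"
  shows "0 \<le> norm_minus A \<phi>"
proof -
  obtain K where K: "0 \<le> K" "\<And>h. h \<in> H_plus A \<Longrightarrow> cmod (\<phi> h) \<le> K * norm_plus A h"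
    using H_minus_bound[OF \<phi>] by blast
  let ?S = "{h \<in> H_plus A. norm_plus A h \<le> 1}"
  have "norm_plus A 0 \<le> 0"
    using norm_plus_adjoint_le[OF linear_relation_zero[OF linear_relation_adjoint]] by simp
  then have "0 \<in> ?S"
    using complex_vector.subspace_0[OF csubspace_H_plus] by simp
  moreover have "bdd_above ((\<lambda>h. cmod (\<phi> h)) ` ?S)"
  proof (rule bdd_aboveI2)
    fix h assume "h \<in> ?S"
    then show "cmod (\<phi> h) \<le> K"
      using K(2)[of h] mult_left_mono[of "norm_plus A h" 1 K] K(1) by simp
  qed
  ultimately have "cmod (\<phi> 0) \<le> norm_minus A \<phi>"
    unfolding norm_minus_def by (rule cSUP_upper)
  then show ?thesis
    using norm_ge_zero order_trans by blast
qed

text \<open>In the model \<open>\<psi>\<close> is represented by some \<open>w\<close>, and \<open>f \<in> \<HH>\<close> by \<open>(f, 0, f)\<close> modulo the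
  orthogonal complement of the model.  Vectors of the second kind are dense in \<open>\<HH>\<^sup>3\<close>, because
  \<open>h\<^sub>0 + h\<^sub>1 = 0\<close> forces an element of the model to vanish.\<close>

lemma H_dense_in_H_minus:
  assumes \<psi>: "\<psi> \<in> H_minus A" and e: "0 < e"
  obtains w where "\<And>h. h \<in> H_plus A \<Longrightarrow> cmod (\<psi> h - cinner w h) \<le> e * norm_plus A h"
proof -
  let ?F = "rigging_model A"
  define \<pi> :: "'a \<times> 'a \<times> 'a \<Rightarrow> 'a" where "\<pi> = (\<lambda>x. fst x + snd (snd x))"
  have \<pi>F: "\<pi> x \<in> H_plus A" and \<pi>_norm: "norm_plus A (\<pi> x) = norm x" if "x \<in> ?F" for x
    using that model_in_H_plus model_norm by (cases x; simp add: \<pi>_def)+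
  have \<pi>_add: "\<pi> (x + y) = \<pi> x + \<pi> y" for x y
    by (simp add: \<pi>_def algebra_simps)
  have \<pi>_scale: "\<pi> (r *\<^sub>R x) = complex_of_real r *\<^sub>C \<pi> x" for r x
    by (simp add: \<pi>_def scaleR_add_right flip: scaleR_scaleC)
  obtain K where K: "\<And>h. h \<in> H_plus A \<Longrightarrow> cmod (\<psi> h) \<le> K * norm_plus A h"
    using H_minus_bound[OF \<psi>] by metis
  obtain y where y: "\<And>x. x \<in> ?F \<Longrightarrow> Re (\<psi> (\<pi> x)) = inner y x"
  proof (rule riesz_representation[OF subspace_model closed_model, of "\<lambda>x. Re (\<psi> (\<pi> x))" K])
    fix x assume x: "x \<in> ?F"
    show "\<bar>Re (\<psi> (\<pi> x))\<bar> \<le> K * norm x"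
      using order_trans[OF abs_Re_le_cmod K[OF \<pi>F[OF x]]] by (simp add: \<pi>_norm[OF x])
  qed (use \<psi> \<pi>F in \<open>auto simp: \<pi>_add \<pi>_scale H_minus_add H_minus_scaleC\<close>)
  define L where "L = {l. \<exists>f. \<forall>x\<in>?F. inner (l - (f, 0, f)) x = 0}"
  have L_iff: "l \<in> L \<longleftrightarrow> (\<exists>f. \<forall>x\<in>?F. inner (l - (f, 0, f)) x = 0)" for l
    by (simp add: L_def)
  have "subspace L"
  proof (rule subspaceI)
    show "0 \<in> L"
      unfolding L_iff by (intro exI[of _ 0]) (auto simp: zero_prod_def)
  next
    fix l m assume "l \<in> L" "m \<in> L"
    then obtain f g where "\<forall>x\<in>?F. inner (l - (f, 0, f)) x = 0" "\<forall>x\<in>?F. inner (m - (g, 0, g)) x = 0"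
      unfolding L_iff by blast
    then have "\<forall>x\<in>?F. inner (l + m - (f + g, 0, f + g)) x = 0"
      by (auto simp: inner_diff_left inner_add_left algebra_simps)
    then show "l + m \<in> L"
      unfolding L_iff by blast
  next
    fix l and c :: real assume "l \<in> L"
    then obtain f where "\<forall>x\<in>?F. inner (l - (f, 0, f)) x = 0"
      unfolding L_iff by blast
    then have "\<forall>x\<in>?F. inner (c *\<^sub>R (l - (f, 0, f))) x = 0"
      by simp
    then have "\<forall>x\<in>?F. inner (c *\<^sub>R l - (c *\<^sub>R f, 0, c *\<^sub>R f)) x = 0"
      by (simp add: scaleR_diff_right)
    then show "c *\<^sub>R l \<in> L"
      unfolding L_iff by blast
  qed
  moreover have "t = 0" if t: "\<And>l. l \<in> L \<Longrightarrow> inner t l = 0" for t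
  proof -
    obtain s where s: "s \<in> ?F" "\<And>x. x \<in> ?F \<Longrightarrow> inner (t - s) x = 0"
      using orthogonal_projection_exists[OF subspace_model closed_model] by blast
    \<comment> \<open>Being orthogonal to the model, \<open>t - s\<close> belongs to
      \<open>L\<close> with witness 0. Both \<open>t\<close> and \<open>s\<close> are orthogonal to
      it, so it vanishes and \<open>t\<close> lies in the model.\<close>
    then have "t - s \<in> L"
      unfolding L_iff by (intro exI[of _ 0]) (auto simp flip: zero_prod_def)
    then have "inner (t - s) (t - s) = 0"
      using t[of "t - s"] s(2)[OF s(1)] by (simp add: inner_diff_left inner_diff_right inner_commute)
    then have tF: "t \<in> ?F"
      using s(1) by simp
    obtain t\<^sub>0 k t\<^sub>1 where tt: "t = (t\<^sub>0, k, t\<^sub>1)"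
      by (cases t)
    have "(t\<^sub>0 + t\<^sub>1, 0, t\<^sub>0 + t\<^sub>1) \<in> L"
      unfolding L_iff by (intro exI[of _ "t\<^sub>0 + t\<^sub>1"]) (simp flip: zero_prod_def)
    then have "inner t (t\<^sub>0 + t\<^sub>1, 0, t\<^sub>0 + t\<^sub>1) = 0"
      by (rule t)
    then have "inner (t\<^sub>0 + t\<^sub>1) (t\<^sub>0 + t\<^sub>1) = 0"
      by (simp add: tt inner_add_left)
    then have sum: "t\<^sub>0 + t\<^sub>1 = 0 + 0"
      by simp
    have "(0, 0) \<in> adjoint_rel A" "0 \<in> mul_rel A"
      using linear_relation_zero[OF linear_relation_adjoint]
        complex_vector.subspace_0[OF csubspace_mul_rel[OF linear]] by blast+
    then have "t\<^sub>0 = 0" "t\<^sub>1 = 0" "P k = P 0"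
      using rigging_decomposition_unique[OF _ _ _ _ sum, of k 0] tF tt
      by (auto simp: rigging_model_def)
    then show "t = 0"
      using tF tt P_fixed P_fixed[OF complex_vector.subspace_0[OF csubspace_H0]]
      by (auto simp: rigging_model_def zero_prod_def)
  qed
  ultimately have "closure L = UNIV"
    by (rule closure_eq_UNIV_if_orthogonal_trivial)
  then obtain l where l: "l \<in> L" "dist l y < e"
    using e closure_approachable[of y L] by auto
  then obtain w where w: "\<And>x. x \<in> ?F \<Longrightarrow> inner (l - (w, 0, w)) x = 0"
    unfolding L_iff by blast
  have Re_bound: "Re (\<psi> h - cinner w h) \<le> e * norm_plus A h" if h: "h \<in> H_plus A" for h
  proof -
    obtain x where x: "x \<in> ?F" "h = \<pi> x"
      using H_plus_model[OF h] by (metis \<pi>_def fst_conv snd_conv)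
    have "Re (cinner w h) = inner (w, 0, w) x"
      by (cases x) (simp add: x \<pi>_def inner_add_right flip: inner_eq_Re_cinner)
    also have "\<dots> = inner l x"
      using w[OF x(1)] by (simp add: inner_diff_left)
    finally have "Re (\<psi> h - cinner w h) = inner (y - l) x"
      using y[OF x(1)] by (simp add: x inner_diff_left)
    also have "\<dots> \<le> norm (y - l) * norm x"
      by (rule norm_cauchy_schwarz)
    also have "\<dots> \<le> e * norm x"
      using l by (intro mult_right_mono) (simp_all add: dist_norm norm_minus_commute)
    finally show ?thesis
      by (simp add: x \<pi>_norm)
  qed
  have scale_eq: "norm_plus A (c *\<^sub>C h) = norm_plus A h" if h: "h \<in> H_plus A" and c: "cmod c = 1" for h c
  proof -
    obtain h\<^sub>0 k h\<^sub>1 where x: "(h\<^sub>0, k, h\<^sub>1) \<in> ?F" "h = h\<^sub>0 + h\<^sub>1"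
      using H_plus_model[OF h] .
    show ?thesis
      using model_norm[OF x(1)] model_norm[OF linear_model(2)[OF x(1) x(1), of c]] c
      by (simp add: x(2) scaleC_add_right norm_Pair norm_scaleC)
  qed
  have "cmod (\<psi> h - cinner w h) \<le> e * norm_plus A h" if h: "h \<in> H_plus A" for h
  proof -
    \<comment> \<open>The real-part bound becomes a bound on the modulus by rotating
      \<open>h\<close>; the factor is \<open>cnj c\<close> because both functionals are
      conjugate-linear, and the rotation preserves \<open>norm_plus\<close>.\<close>
    obtain c where c: "cmod c = 1" "c * (\<psi> h - cinner w h) = complex_of_real (cmod (\<psi> h - cinner w h))"
      using complex_unimodular_rotation .
    then have "cmod (\<psi> h - cinner w h) = Re (\<psi> (cnj c *\<^sub>C h) - cinner w (cnj c *\<^sub>C h))"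
      using H_minus_scaleC[OF \<psi> h] by (simp add: cinner_scaleC_right flip: right_diff_distrib)
    also have "\<dots> \<le> e * norm_plus A (cnj c *\<^sub>C h)"
      by (intro Re_bound complex_vector.subspace_scale csubspace_H_plus h)
    finally show ?thesis
      using scale_eq[OF h, of "cnj c"] c by simp
  qed
  then show thesis
    by (rule that)
qed

end

section \<open>Boundary triples and the regularizer\<close>

text \<open>Representing the real part suffices, since the imaginary part of \<open>\<phi> x\<close>
  is the real part of \<open>\<phi> (\<i> *\<^sub>C x)\<close>.\<close>

lemma conjugate_linear_riesz:
  fixes \<phi> :: "'a::complex_hilbert_space \<Rightarrow> complex"
  assumes add: "\<And>x y. \<phi> (x + y) = \<phi> x + \<phi> y"
    and scale: "\<And>c x. \<phi> (c *\<^sub>C x) = cnj c * \<phi> x"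
    and bound: "\<And>x. cmod (\<phi> x) \<le> K * norm x"
  obtains w where "\<And>x. \<phi> x = cinner w x"
proof -
  obtain w where w: "\<And>x. Re (\<phi> x) = inner w x"
  proof (rule riesz_representation[of UNIV "\<lambda>x. Re (\<phi> x)" K])
    show "\<bar>Re (\<phi> x)\<bar> \<le> K * norm x" for x
      using bound[of x] abs_Re_le_cmod[of "\<phi> x"] by linarith
  qed (auto simp: add scale scaleR_scaleC)
  have "\<phi> x = cinner w x" for x
    using w[of x] w[of "\<i> *\<^sub>C x"] by (intro complex_eqI) (simp_all add: cinner_eq_Complex scale)
  then show thesis
    by (rule that)
qed

lemma rigged_adjoint_eqI:
  assumes "\<And>g. cinner w g = \<phi> (T g)"
  shows "rigged_adjoint T \<phi> = w"
  unfolding rigged_adjoint_def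
proof (rule the_equality)
  fix u assume "\<forall>g. cinner u g = \<phi> (T g)"
  then show "u = w"
    using assms by (intro cinner_ext) simp
qed (simp add: assms)

lemma cmod_cscalar_prod_le:
  assumes "u \<in> carrier_vec p" "v \<in> carrier_vec p"
  shows "cmod (u \<bullet>c v) \<le> L2_set (\<lambda>i. cmod (u $ i)) {..<p} * L2_set (\<lambda>i. cmod (v $ i)) {..<p}"
proof -
  have "u \<bullet>c v = (\<Sum>i<p. u $ i * cnj (v $ i))"
    using assms by (simp add: scalar_prod_def lessThan_atLeast0 carrier_vecD)
  then have "cmod (u \<bullet>c v) \<le> (\<Sum>i<p. \<bar>cmod (u $ i)\<bar> * \<bar>cmod (v $ i)\<bar>)"
    by (simp add: order_trans[OF norm_sum] norm_mult)
  also have "\<dots> \<le> L2_set (\<lambda>i. cmod (u $ i)) {..<p} * L2_set (\<lambda>i. cmod (v $ i)) {..<p}"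
    by (rule L2_set_mult_ineq)
  finally show ?thesis .
qed

lemma cnj_cscalar_prod:
  fixes u v :: "complex vec"
  assumes "u \<in> carrier_vec p" "v \<in> carrier_vec p"
  shows "cnj (u \<bullet>c v) = v \<bullet>c u"
  using assms by (simp add: scalar_prod_def carrier_vecD mult.commute)

locale boundary_triple_relation = closed_relation A
  for A :: "('a::complex_hilbert_space \<times> 'a) set" +
  fixes p :: nat and \<Gamma>\<^sub>0 \<Gamma>\<^sub>1 :: "'a \<times> 'a \<Rightarrow> complex vec"
  assumes symmetric_A: "symmetric_rel A" and triple: "boundary_triple p A \<Gamma>\<^sub>0 \<Gamma>\<^sub>1"
begin

abbreviation A\<^sub>0 :: "('a \<times> 'a) set" where
  "A\<^sub>0 \<equiv> ker_ext p A \<Gamma>\<^sub>0"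

lemma \<Gamma>_carrier:
  assumes "x \<in> adjoint_rel A"
  shows "\<Gamma>\<^sub>0 x \<in> carrier_vec p" "\<Gamma>\<^sub>1 x \<in> carrier_vec p"
  using triple assms unfolding boundary_triple_def linear_to_vec_def by blast+

lemma Green:
  assumes "(f, f') \<in> adjoint_rel A" "(g, g') \<in> adjoint_rel A"
  shows "cinner f' g - cinner f g' =
    \<Gamma>\<^sub>1 (f, f') \<bullet>c \<Gamma>\<^sub>0 (g, g') - \<Gamma>\<^sub>0 (f, f') \<bullet>c \<Gamma>\<^sub>1 (g, g')"
  using triple assms unfolding boundary_triple_def by blast

lemma \<Gamma>_surj:
  assumes "u \<in> carrier_vec p" "v \<in> carrier_vec p"
  obtains k k' where "(k, k') \<in> adjoint_rel A" "\<Gamma>\<^sub>0 (k, k') = u" "\<Gamma>\<^sub>1 (k, k') = v"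
proof -
  have "\<exists>x\<in>adjoint_rel A. \<Gamma>\<^sub>0 x = u \<and> \<Gamma>\<^sub>1 x = v"
    using triple assms unfolding boundary_triple_def by blast
  then show thesis
    using that by force
qed

lemma A0_subset_adjoint: "A\<^sub>0 \<subseteq> adjoint_rel A"
  by (auto simp: ker_ext_def)

lemma A0_iff: "(f, f') \<in> A\<^sub>0 \<longleftrightarrow> (f, f') \<in> adjoint_rel A \<and> \<Gamma>\<^sub>0 (f, f') = 0\<^sub>v p"
  by (simp add: ker_ext_def)

text \<open>Surjectivity provides a test element of \<open>A\<^sub>0\<close> with
  \<open>\<Gamma>\<^sub>1\<close> equal to the unknown value
  \<open>\<Gamma>\<^sub>0 (f, f')\<close>. Green's identity then makes the square of that value
  zero.\<close>

lemma in_A0I: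
  assumes f: "(f, f') \<in> adjoint_rel A"
    and orth: "\<And>k k'. (k, k') \<in> A\<^sub>0 \<Longrightarrow> cinner f' k = cinner f k'"
  shows "(f, f') \<in> A\<^sub>0"
proof -
  obtain k k' where k: "(k, k') \<in> adjoint_rel A" "\<Gamma>\<^sub>0 (k, k') = 0\<^sub>v p" "\<Gamma>\<^sub>1 (k, k') = \<Gamma>\<^sub>0 (f, f')"
    using \<Gamma>_surj[OF zero_carrier_vec \<Gamma>_carrier(1)[OF f]] .
  then have "\<Gamma>\<^sub>0 (f, f') \<bullet>c \<Gamma>\<^sub>0 (f, f') = 0"
    using Green[OF f k(1)] orth[of k k'] \<Gamma>_carrier[OF f] by (simp add: A0_iff)
  then show ?thesis
    using f \<Gamma>_carrier[OF f] by (simp add: A0_iff)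
qed

lemma A_subset_A0: "A \<subseteq> A\<^sub>0"
proof clarify
  fix f f' assume f: "(f, f') \<in> A"
  show "(f, f') \<in> A\<^sub>0"
  proof (rule in_A0I)
    show "(f, f') \<in> adjoint_rel A"
      using f symmetric_A unfolding symmetric_rel_def by blast
    fix k k' assume "(k, k') \<in> A\<^sub>0"
    then have "cinner k' f = cinner k f'"
      using f A0_subset_adjoint adjoint_rel_iff by blast
    then show "cinner f' k = cinner f k'"
      by (metis cinner_commute)
  qed
qed

text \<open>On \<open>A\<^sub>0\<close> every boundary term in Green's identity contains a zero
  factor, which gives symmetry. Conversely, \<open>A \<subseteq> A\<^sub>0\<close> puts the adjoint
  of \<open>A\<^sub>0\<close> inside that of \<open>A\<close>, where \<open>in_A0I\<close>
  applies.\<close>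

sublocale A0: selfadjoint_relation A\<^sub>0
proof
  have "cinner f' g = cinner f g'" if "(f, f') \<in> A\<^sub>0" "(g, g') \<in> A\<^sub>0" for f f' g g'
    using Green[of f f' g g'] that \<Gamma>_carrier by (simp add: A0_iff)
  then have "A\<^sub>0 \<subseteq> adjoint_rel A\<^sub>0"
    by (auto simp: adjoint_rel_iff)
  moreover have "adjoint_rel A\<^sub>0 \<subseteq> A\<^sub>0"
    using in_A0I adjoint_rel_antimono[OF A_subset_A0] by (auto simp: adjoint_rel_iff)
  ultimately show "adjoint_rel A\<^sub>0 = A\<^sub>0"
    by blast
qed

lemma A0_in_H_plus: "(k, k') \<in> A\<^sub>0 \<Longrightarrow> k \<in> H_plus A"
  using adjoint_in_H_plus A0_subset_adjoint by blast

lemma norm_plus_resolvent_le: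
  assumes z: "z = \<i> \<or> z = - \<i>"
  shows "norm_plus A (resolvent_rel A\<^sub>0 z g) \<le> 2 * norm g"
proof -
  have "(resolvent_rel A\<^sub>0 z g, g + z *\<^sub>C resolvent_rel A\<^sub>0 z g) \<in> adjoint_rel A"
    using A0.resolvent_mem[OF z] A0_subset_adjoint by blast
  from norm_plus_adjoint_le[OF this] show ?thesis
    using A0.resolvent_bounds[OF z, of g] by linarith
qed

section \<open>Extended resolvents, the regularizer and its companion \<open>coreg\<close>\<close>

definition rigged_resolvent :: "complex \<Rightarrow> ('a \<Rightarrow> complex) \<Rightarrow> 'a" where
  "rigged_resolvent z = rigged_adjoint (resolvent_rel A\<^sub>0 z)"

lemma cinner_rigged_resolvent:
  assumes \<psi>: "\<psi> \<in> H_minus A" and z: "z = \<i> \<or> z = - \<i>"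
  shows "cinner (rigged_resolvent z \<psi>) g = \<psi> (resolvent_rel A\<^sub>0 z g)"
proof -
  let ?R = "resolvent_rel A\<^sub>0 z"
  have R: "?R g \<in> H_plus A" for g
    using A0.resolvent_mem[OF z] A0_in_H_plus by blast
  obtain K where K: "0 \<le> K" "\<And>h. h \<in> H_plus A \<Longrightarrow> cmod (\<psi> h) \<le> K * norm_plus A h"
    using H_minus_bound[OF \<psi>] by blast
  obtain w where w: "\<And>g. \<psi> (?R g) = cinner w g"
  proof (rule conjugate_linear_riesz[of "\<lambda>g. \<psi> (?R g)" "K * 2"])
    show "cmod (\<psi> (?R g)) \<le> K * 2 * norm g" for g
      using K(2)[OF R, of g] mult_left_mono[OF norm_plus_resolvent_le[OF z] K(1), of g] by simp
  qed (simp_all add: A0.resolvent_add[OF z] A0.resolvent_scaleC[OF z] H_minus_add[OF \<psi>]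
      H_minus_scaleC[OF \<psi>] R)
  then have "rigged_resolvent z \<psi> = w"
    unfolding rigged_resolvent_def by (intro rigged_adjoint_eqI) simp
  then show ?thesis
    by (simp add: w)
qed

text \<open>Dualising conjugates the spectral parameter: \<open>rigged_resolvent z\<close> extends
  the resolvent at \<open>cnj z\<close>, and \<open>\<psi>\<close> plus \<open>cnj z\<close> times
  its value is the second component of a singular pair.\<close>

lemma cinner_rigged_resolvent_A0:
  assumes \<psi>: "\<psi> \<in> H_minus A" and z: "z = \<i> \<or> z = - \<i>" and k: "(k, k') \<in> A\<^sub>0"
  shows "cinner (rigged_resolvent z \<psi>) k' = \<psi> k + cnj z * cinner (rigged_resolvent z \<psi>) k"
  using cinner_rigged_resolvent[OF \<psi> z, of "k' - z *\<^sub>C k"] A0.resolvent_eq[OF k z refl]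
  by (simp add: cinner_simps algebra_simps)

lemma rigged_resolvent_add:
  assumes "\<phi> \<in> H_minus A" "\<psi> \<in> H_minus A" and z: "z = \<i> \<or> z = - \<i>"
  shows "rigged_resolvent z (\<phi> + \<psi>) = rigged_resolvent z \<phi> + rigged_resolvent z \<psi>"
  by (rule cinner_ext)
    (simp add: cinner_simps cinner_rigged_resolvent H_minus_plus assms)

text \<open>Testing the defining identity with the vector itself bounds its squared norm by
  \<open>2 * e\<close> times its norm; the 2 is that of
  \<open>norm_plus_resolvent_le\<close>.\<close>

lemma norm_rigged_resolvent_le:
  assumes \<psi>: "\<psi> \<in> H_minus A" and z: "z = \<i> \<or> z = - \<i>"
    and e: "\<And>h. h \<in> H_plus A \<Longrightarrow> cmod (\<psi> h) \<le> e * norm_plus A h" "0 \<le> e"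
  shows "norm (rigged_resolvent z \<psi>) \<le> 2 * e"
proof -
  let ?w = "rigged_resolvent z \<psi>"
  have "complex_of_real ((norm ?w)\<^sup>2) = \<psi> (resolvent_rel A\<^sub>0 z ?w)"
    using cinner_rigged_resolvent[OF \<psi> z, of ?w] by (simp only: cinner_self)
  then have "(norm ?w)\<^sup>2 = cmod (\<psi> (resolvent_rel A\<^sub>0 z ?w))"
    by (metis abs_power2 norm_of_real)
  also have "\<dots> \<le> e * norm_plus A (resolvent_rel A\<^sub>0 z ?w)"
    using A0.resolvent_mem[OF z] A0_in_H_plus by (blast intro: e)
  also have "\<dots> \<le> e * (2 * norm ?w)"
    by (intro mult_left_mono norm_plus_resolvent_le z e)
  finally have "norm ?w * norm ?w \<le> 2 * e * norm ?w"
    by (simp add: power2_eq_square algebra_simps)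
  then show ?thesis
    using e(2) by (cases "norm ?w = 0") (auto simp: mult_le_cancel_right)
qed

abbreviation reg :: "('a \<Rightarrow> complex) \<Rightarrow> 'a" where
  "reg \<equiv> regularizer A\<^sub>0"

text \<open>The elements \<open>(R\<^sub>z \<psi>, \<psi> + z R\<^sub>z \<psi>)\<close> of \<open>\<^bold>A\<^sub>0\<close> with \<open>z = \<i>\<close> and \<open>z = - \<i>\<close>, \<open>R\<^sub>z\<close> being the
  extended resolvent, have the average \<open>(reg \<psi>, \<psi> + coreg \<psi>)\<close>.  Formally \<open>reg\<close> is
  \<open>A\<^sub>0 (1 + A\<^sub>0\<^sup>2)\<^sup>-\<^sup>1\<close> and \<open>coreg\<close> is \<open>- (1 + A\<^sub>0\<^sup>2)\<^sup>-\<^sup>1\<close>.\<close>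

definition coreg :: "('a \<Rightarrow> complex) \<Rightarrow> 'a" where
  "coreg \<psi> = (\<i> / 2) *\<^sub>C (rigged_resolvent (- \<i>) \<psi> - rigged_resolvent \<i> \<psi>)"

lemma reg_eq:
  assumes \<psi>: "\<psi> \<in> H_minus A"
  shows "reg \<psi> = (1 / 2) *\<^sub>C (rigged_resolvent \<i> \<psi> + rigged_resolvent (- \<i>) \<psi>)"
  unfolding regularizer_def
proof (rule rigged_adjoint_eqI)
  fix g
  have "resolvent_rel A\<^sub>0 \<i> g \<in> H_plus A" "resolvent_rel A\<^sub>0 (- \<i>) g \<in> H_plus A"
    using A0.resolvent_mem A0_in_H_plus by blast+
  then show "cinner ((1 / 2) *\<^sub>C (rigged_resolvent \<i> \<psi> + rigged_resolvent (- \<i>) \<psi>)) g =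
      \<psi> ((1 / 2) *\<^sub>C (resolvent_rel A\<^sub>0 \<i> g + resolvent_rel A\<^sub>0 (- \<i>) g))"
    by (simp add: cinner_simps cinner_rigged_resolvent[OF \<psi>] H_minus_scaleC[OF \<psi>]
        H_minus_add[OF \<psi>] complex_vector.subspace_add[OF csubspace_H_plus])
qed

lemma reg_coreg_A0:
  assumes \<psi>: "\<psi> \<in> H_minus A" and k: "(k, k') \<in> A\<^sub>0"
  shows "\<psi> k + cinner (coreg \<psi>) k = cinner (reg \<psi>) k'"
  by (simp add: reg_eq[OF \<psi>] coreg_def cinner_simps cinner_rigged_resolvent_A0[OF \<psi> _ k]
      field_simps)

text \<open>In the difference of the two extended resolvents the terms \<open>\<psi> k\<close>
  cancel, so no singular part remains and selfadjointness yields an ordinary element of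
  \<open>A\<^sub>0\<close>.\<close>

lemma coreg_reg_mem:
  assumes \<psi>: "\<psi> \<in> H_minus A"
  shows "(coreg \<psi>, - reg \<psi>) \<in> A\<^sub>0"
proof (rule A0.memI)
  fix k k' assume k: "(k, k') \<in> A\<^sub>0"
  show "cinner (- reg \<psi>) k = cinner (coreg \<psi>) k'"
    by (simp add: reg_eq[OF \<psi>] coreg_def cinner_simps cinner_rigged_resolvent_A0[OF \<psi> _ k]
        field_simps)
qed

lemma reg_coreg_symmetric:
  assumes "\<phi> \<in> H_minus A" "\<psi> \<in> H_minus A"
  shows "cinner (reg \<phi>) (coreg \<psi>) = cinner (coreg \<phi>) (reg \<psi>)"
  using A0.symmetric[OF coreg_reg_mem[OF assms(1)] coreg_reg_mem[OF assms(2)]]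
  by (simp add: cinner_simps)

lemma reg_coreg_add:
  assumes "\<phi> \<in> H_minus A" "\<psi> \<in> H_minus A"
  shows "reg (\<phi> + \<psi>) = reg \<phi> + reg \<psi>" and "coreg (\<phi> + \<psi>) = coreg \<phi> + coreg \<psi>"
  by (simp_all add: reg_eq coreg_def assms H_minus_plus rigged_resolvent_add
      scaleC_add_right complex_vector.scale_right_diff_distrib)

lemma norm_reg_coreg_le:
  assumes \<psi>: "\<psi> \<in> H_minus A"
    and e: "\<And>h. h \<in> H_plus A \<Longrightarrow> cmod (\<psi> h) \<le> e * norm_plus A h" "0 \<le> e"
  shows "norm (reg \<psi>) \<le> 2 * e" and "norm (coreg \<psi>) \<le> 2 * e"
proof -
  have "norm (rigged_resolvent \<i> \<psi>) \<le> 2 * e" "norm (rigged_resolvent (- \<i>) \<psi>) \<le> 2 * e"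
    by (rule norm_rigged_resolvent_le[OF \<psi> _ e]; simp)+
  then show "norm (reg \<psi>) \<le> 2 * e" "norm (coreg \<psi>) \<le> 2 * e"
    using norm_triangle_ineq[of "rigged_resolvent \<i> \<psi>" "rigged_resolvent (- \<i>) \<psi>"]
      norm_triangle_ineq4[of "rigged_resolvent (- \<i>) \<psi>" "rigged_resolvent \<i> \<psi>"]
    by (simp_all add: reg_eq[OF \<psi>] coreg_def norm_scaleC norm_divide)
qed

text \<open>For an embedded vector, \<open>reg_coreg_A0\<close> is literally the test for membership
  in the selfadjoint \<open>A\<^sub>0\<close>.\<close>

lemma reg_coreg_embed:
  "(reg (embed_minus A w), w + coreg (embed_minus A w)) \<in> A\<^sub>0"
  using reg_coreg_A0[OF embed_minus_in_H_minus, of _ _ w] A0_in_H_plus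
  by (intro A0.memI) (simp add: cinner_add_left embed_minus_apply)

section \<open>Cancelling the singular part with elements lifted from
  \<open>H_minus A\<close>\<close>

definition lift :: "('a \<Rightarrow> complex) \<Rightarrow> 'a \<times> ('a \<Rightarrow> complex)" where
  "lift \<psi> = (reg \<psi>, \<psi> + embed_minus A (coreg \<psi>))"

lemma lift_mem:
  assumes \<psi>: "\<psi> \<in> H_minus A"
  shows "lift \<psi> \<in> rigged_adjoint_rel A"
proof -
  have "\<psi> h + embed_minus A (coreg \<psi>) h = cinner (reg \<psi>) h'" if "(h, h') \<in> A" for h h'
  proof -
    have h: "(h, h') \<in> A\<^sub>0"
      using that A_subset_A0 by blast
    show ?thesis
      by (simp add: embed_minus_apply[OF A0_in_H_plus[OF h]] reg_coreg_A0[OF \<psi> h])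
  qed
  then show ?thesis
    using \<psi> by (auto simp: rigged_adjoint_rel_def lift_def H_minus_plus embed_minus_in_H_minus)
qed

lemma lift_add:
  assumes "\<phi> \<in> H_minus A" "\<psi> \<in> H_minus A"
  shows "lift (\<phi> + \<psi>) = lift \<phi> + lift \<psi>"
  by (simp add: lift_def reg_coreg_add[OF assms] embed_minus_add algebra_simps)

lemma regularized_mem_adjoint:
  assumes f: "(f, f') \<in> rigged_adjoint_rel A" and ft: "ft \<in> H_minus A"
    and u: "f' + ft = embed_minus A u"
  shows "(f + reg ft, u + coreg ft) \<in> adjoint_rel A"
  unfolding adjoint_rel_iff
proof (intro allI impI)
  fix h h' assume h: "(h, h') \<in> A"
  then have h0: "(h, h') \<in> A\<^sub>0"
    using A_subset_A0 by blast
  have "cinner u h = f' h + ft h"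
    using fun_cong[OF u, of h] by (simp add: embed_minus_apply[OF A0_in_H_plus[OF h0]])
  moreover have "f' h = cinner f h'"
    using f h by (auto simp: rigged_adjoint_rel_def)
  ultimately show "cinner (u + coreg ft) h = cinner (f + reg ft) h'"
    by (simp add: cinner_add_left add_ac flip: reg_coreg_A0[OF ft h0])
qed

end

section \<open>Extended boundary triples\<close>

locale extended_triple_relation = boundary_triple_relation A p \<Gamma>\<^sub>0 \<Gamma>\<^sub>1
  for A :: "('a::complex_hilbert_space \<times> 'a) set" and p \<Gamma>\<^sub>0 \<Gamma>\<^sub>1 +
  fixes G\<^sub>0 G\<^sub>1 :: "'a \<times> ('a \<Rightarrow> complex) \<Rightarrow> complex vec"
  assumes continuation: "bounded_continuation p A \<Gamma>\<^sub>0 G\<^sub>0" "bounded_continuation p A \<Gamma>\<^sub>1 G\<^sub>1"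
begin

lemma G_carrier:
  assumes "x \<in> rigged_adjoint_rel A"
  shows "G\<^sub>0 x \<in> carrier_vec p" "G\<^sub>1 x \<in> carrier_vec p"
  using continuation assms unfolding bounded_continuation_def linear_to_vec_def by blast+

lemma G_add:
  assumes "x \<in> rigged_adjoint_rel A" "y \<in> rigged_adjoint_rel A"
  shows "G\<^sub>0 (x + y) = G\<^sub>0 x + G\<^sub>0 y" "G\<^sub>1 (x + y) = G\<^sub>1 x + G\<^sub>1 y"
  using continuation assms unfolding bounded_continuation_def linear_to_vec_def by blast+

lemma G_embed:
  assumes "(f, f') \<in> adjoint_rel A"
  shows "G\<^sub>0 (f, embed_minus A f') = \<Gamma>\<^sub>0 (f, f')" "G\<^sub>1 (f, embed_minus A f') = \<Gamma>\<^sub>1 (f, f')"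
  using continuation assms unfolding bounded_continuation_def by blast+

text \<open>Phrased through an arbitrary bound \<open>e\<close> instead of
  \<open>norm_minus A \<psi>\<close>, the form in which the density lemma delivers its
  estimate.\<close>

lemma continuation_lift_bound:
  assumes G: "bounded_continuation p A \<Gamma> G"
  shows "\<exists>K\<ge>0. \<forall>\<psi>\<in>H_minus A. \<forall>e\<ge>0. (\<forall>h\<in>H_plus A. cmod (\<psi> h) \<le> e * norm_plus A h) \<longrightarrow>
    L2_set (\<lambda>i. cmod (G (lift \<psi>) $ i)) {..<p} \<le> K * e"
proof -
  obtain K where K: "\<And>f \<phi>. (f, \<phi>) \<in> rigged_adjoint_rel A \<Longrightarrow>
      L2_set (\<lambda>i. cmod (G (f, \<phi>) $ i)) {..<p} \<le> K * (norm f + norm_minus A \<phi>)"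
    using G unfolding bounded_continuation_def by blast
  \<comment> \<open>The 5 is 2 for \<open>reg \<psi>\<close> plus 3 for the functional component,
    namely 1 for \<open>\<psi>\<close> and 2 for \<open>coreg \<psi>\<close>. The absolute value is
    taken because \<open>K\<close> has no known sign.\<close>
  have "L2_set (\<lambda>i. cmod (G (lift \<psi>) $ i)) {..<p} \<le> (\<bar>K\<bar> * 5) * e"
    if \<psi>: "\<psi> \<in> H_minus A" and e: "\<And>h. h \<in> H_plus A \<Longrightarrow> cmod (\<psi> h) \<le> e * norm_plus A h" "0 \<le> e" for \<psi> e
  proof -
    let ?\<phi> = "\<psi> + embed_minus A (coreg \<psi>)"
    note bounds = norm_reg_coreg_le[OF \<psi> e]
    have "cmod (?\<phi> h) \<le> (3 * e) * norm_plus A h" if h: "h \<in> H_plus A" for h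
    proof -
      have "cmod (cinner (coreg \<psi>) h) \<le> norm (coreg \<psi>) * norm h"
        by (rule norm_cinner_le)
      also have "\<dots> \<le> (2 * e) * norm_plus A h"
        using bounds norm_le_norm_plus[OF h] e(2) by (intro mult_mono) auto
      finally show ?thesis
        using norm_triangle_ineq[of "\<psi> h" "cinner (coreg \<psi>) h"] e(1)[OF h]
        by (simp add: embed_minus_apply[OF h])
    qed
    then have "norm_minus A ?\<phi> \<le> 3 * e"
      using e(2) by (intro norm_minus_le) auto
    moreover have "0 \<le> norm_minus A ?\<phi>"
      by (intro norm_minus_nonneg H_minus_plus embed_minus_in_H_minus \<psi>)
    ultimately have "0 \<le> norm (reg \<psi>) + norm_minus A ?\<phi>" "norm (reg \<psi>) + norm_minus A ?\<phi> \<le> 5 * e"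
      using bounds by auto
    then have "K * (norm (reg \<psi>) + norm_minus A ?\<phi>) \<le> \<bar>K\<bar> * (5 * e)"
      by (intro mult_mono) auto
    then show ?thesis
      using order_trans[OF K[OF lift_mem[OF \<psi>, unfolded lift_def]]]
      by (simp add: lift_def)
  qed
  then show ?thesis
    by (intro exI[of _ "\<bar>K\<bar> * 5"]) simp
qed

text \<open>Both sides are additive in \<open>\<psi>\<close> and bounded for the norm of \<open>\<HH>\<^sub>-\<close>; for \<open>\<psi> \<in> \<HH>\<close> this is Green's
  identity on \<open>A\<^sup>*\<close>.\<close>

lemma Green_lift:
  assumes \<psi>: "\<psi> \<in> H_minus A" and k: "(k, k') \<in> adjoint_rel A"
  shows "\<psi> k + cinner (coreg \<psi>) k - cinner (reg \<psi>) k' =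
    G\<^sub>1 (lift \<psi>) \<bullet>c \<Gamma>\<^sub>0 (k, k') - G\<^sub>0 (lift \<psi>) \<bullet>c \<Gamma>\<^sub>1 (k, k')"
proof -
  note kplus = adjoint_in_H_plus[OF k]
  note vec = \<Gamma>_carrier[OF k]
  note Gvec = G_carrier[OF lift_mem]
  define D where "D \<phi> = \<phi> k + cinner (coreg \<phi>) k - cinner (reg \<phi>) k' -
    (G\<^sub>1 (lift \<phi>) \<bullet>c \<Gamma>\<^sub>0 (k, k') - G\<^sub>0 (lift \<phi>) \<bullet>c \<Gamma>\<^sub>1 (k, k'))" for \<phi>
  have D_add: "D (\<phi> + \<chi>) = D \<phi> + D \<chi>" if "\<phi> \<in> H_minus A" "\<chi> \<in> H_minus A" for \<phi> \<chi>
    using that vec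
    by (simp add: D_def reg_coreg_add lift_add G_add lift_mem cinner_add_left
        add_scalar_prod_distrib[OF Gvec(1) Gvec(1)] add_scalar_prod_distrib[OF Gvec(2) Gvec(2)])
  \<comment> \<open>Here \<open>lift\<close> gives an embedded element of the adjoint, on which
    \<open>G\<^sub>0\<close> and \<open>G\<^sub>1\<close> are the original boundary maps.\<close>
  have D_embed: "D (embed_minus A w) = 0" for w
  proof -
    have mem: "(reg (embed_minus A w), w + coreg (embed_minus A w)) \<in> adjoint_rel A"
      using reg_coreg_embed A0_subset_adjoint by blast
    show ?thesis
      using Green[OF mem k] G_embed[OF mem]
      by (simp add: D_def lift_def embed_minus_add embed_minus_apply[OF kplus] cinner_add_left)
  qed
  obtain K\<^sub>0 where K\<^sub>0: "0 \<le> K\<^sub>0"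
    "\<And>\<psi> e. \<psi> \<in> H_minus A \<Longrightarrow> \<forall>h\<in>H_plus A. cmod (\<psi> h) \<le> e * norm_plus A h \<Longrightarrow> 0 \<le> e \<Longrightarrow>
      L2_set (\<lambda>i. cmod (G\<^sub>0 (lift \<psi>) $ i)) {..<p} \<le> K\<^sub>0 * e"
    using continuation_lift_bound[OF continuation(1)] by blast
  obtain K\<^sub>1 where K\<^sub>1: "0 \<le> K\<^sub>1"
    "\<And>\<psi> e. \<psi> \<in> H_minus A \<Longrightarrow> \<forall>h\<in>H_plus A. cmod (\<psi> h) \<le> e * norm_plus A h \<Longrightarrow> 0 \<le> e \<Longrightarrow>
      L2_set (\<lambda>i. cmod (G\<^sub>1 (lift \<psi>) $ i)) {..<p} \<le> K\<^sub>1 * e"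
    using continuation_lift_bound[OF continuation(2)] by blast
  define C where "C = norm_plus A k + 2 * norm k + 2 * norm k' +
    K\<^sub>1 * L2_set (\<lambda>i. cmod (\<Gamma>\<^sub>0 (k, k') $ i)) {..<p} + K\<^sub>0 * L2_set (\<lambda>i. cmod (\<Gamma>\<^sub>1 (k, k') $ i)) {..<p}"
  have C: "0 \<le> C"
    unfolding C_def using K\<^sub>0(1) K\<^sub>1(1) norm_plus_nonneg[OF kplus]
    by (intro add_nonneg_nonneg mult_nonneg_nonneg) auto
  have D_bound: "cmod (D \<phi>) \<le> C * e"
    if \<phi>: "\<phi> \<in> H_minus A" and e: "\<And>h. h \<in> H_plus A \<Longrightarrow> cmod (\<phi> h) \<le> e * norm_plus A h" "0 \<le> e" for \<phi> e
  proof -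
    note bounds = norm_reg_coreg_le[OF \<phi> e]
    have e': "\<forall>h\<in>H_plus A. cmod (\<phi> h) \<le> e * norm_plus A h"
      using e by blast
    have "cmod (cinner (coreg \<phi>) k) \<le> (2 * e) * norm k"
      by (rule order_trans[OF norm_cinner_le mult_right_mono[OF bounds(2) norm_ge_zero]])
    moreover have "cmod (cinner (reg \<phi>) k') \<le> (2 * e) * norm k'"
      by (rule order_trans[OF norm_cinner_le mult_right_mono[OF bounds(1) norm_ge_zero]])
    moreover have "cmod (G\<^sub>1 (lift \<phi>) \<bullet>c \<Gamma>\<^sub>0 (k, k')) \<le>
        (K\<^sub>1 * e) * L2_set (\<lambda>i. cmod (\<Gamma>\<^sub>0 (k, k') $ i)) {..<p}"
      by (rule order_trans[OF cmod_cscalar_prod_le[OF Gvec(2)[OF \<phi>] vec(1)]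
            mult_right_mono[OF K\<^sub>1(2)[OF \<phi> e' e(2)]]]) simp_all
    moreover have "cmod (G\<^sub>0 (lift \<phi>) \<bullet>c \<Gamma>\<^sub>1 (k, k')) \<le>
        (K\<^sub>0 * e) * L2_set (\<lambda>i. cmod (\<Gamma>\<^sub>1 (k, k') $ i)) {..<p}"
      by (rule order_trans[OF cmod_cscalar_prod_le[OF Gvec(1)[OF \<phi>] vec(2)]
            mult_right_mono[OF K\<^sub>0(2)[OF \<phi> e' e(2)]]]) simp_all
    moreover have "cmod (D \<phi>) \<le> cmod (\<phi> k) + cmod (cinner (coreg \<phi>) k) + cmod (cinner (reg \<phi>) k') +
        (cmod (G\<^sub>1 (lift \<phi>) \<bullet>c \<Gamma>\<^sub>0 (k, k')) + cmod (G\<^sub>0 (lift \<phi>) \<bullet>c \<Gamma>\<^sub>1 (k, k')))"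
      unfolding D_def
      by (intro order_trans[OF norm_triangle_ineq4] add_mono norm_triangle_ineq norm_triangle_ineq4)
        simp
    ultimately have "cmod (D \<phi>) \<le> e * norm_plus A k + (2 * e) * norm k + (2 * e) * norm k' +
        ((K\<^sub>1 * e) * L2_set (\<lambda>i. cmod (\<Gamma>\<^sub>0 (k, k') $ i)) {..<p} +
         (K\<^sub>0 * e) * L2_set (\<lambda>i. cmod (\<Gamma>\<^sub>1 (k, k') $ i)) {..<p})"
      using e(1)[OF kplus] by linarith
    also have "\<dots> = C * e"
      by (simp add: C_def algebra_simps)
    finally show ?thesis .
  qed
  have small: "cmod (D \<psi>) \<le> C * e" if e: "0 < e" for e
  proof -
    obtain w where w: "\<And>h. h \<in> H_plus A \<Longrightarrow> cmod (\<psi> h - cinner w h) \<le> e * norm_plus A h"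
      using H_dense_in_H_minus[OF \<psi> e] by blast
    define \<phi> where "\<phi> = \<psi> + (- embed_minus A w)"
    have \<phi>: "\<phi> \<in> H_minus A"
      unfolding \<phi>_def by (intro H_minus_plus H_minus_uminus embed_minus_in_H_minus \<psi>)
    have "\<psi> = \<phi> + embed_minus A w"
      by (simp add: \<phi>_def)
    then have "D \<psi> = D \<phi>"
      using D_add[OF \<phi> embed_minus_in_H_minus] D_embed by simp
    moreover have "cmod (D \<phi>) \<le> C * e"
      using w e by (intro D_bound[OF \<phi>]) (auto simp: \<phi>_def embed_minus_apply)
    ultimately show ?thesis
      by simp
  qed
  have "D \<psi> = 0"
  proof (rule ccontr)
    assume "D \<psi> \<noteq> 0"
    \<comment> \<open>This choice of \<open>e\<close> yields the factor \<open>C / (C + 1)\<close>,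
      which is less than 1.\<close>
    then have "cmod (D \<psi>) \<le> C * (cmod (D \<psi>) / (C + 1))"
      using C by (intro small) simp
    then show False
      using C \<open>D \<psi> \<noteq> 0\<close> by (simp add: field_simps)
  qed
  then show ?thesis
    by (simp add: D_def)
qed

text \<open>Same device as in \<open>in_A0I\<close>: for a test element of \<open>A\<^sub>0\<close>
  the left side of \<open>Green_lift\<close> vanishes, and \<open>\<Gamma>\<^sub>1\<close> of that
  element can be prescribed as the value in question.\<close>

lemma G0_lift:
  assumes \<psi>: "\<psi> \<in> H_minus A"
  shows "G\<^sub>0 (lift \<psi>) = 0\<^sub>v p"
proof -
  note vec = G_carrier[OF lift_mem[OF \<psi>]]
  obtain k k' where k: "(k, k') \<in> adjoint_rel A" "\<Gamma>\<^sub>0 (k, k') = 0\<^sub>v p" "\<Gamma>\<^sub>1 (k, k') = G\<^sub>0 (lift \<psi>)"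
    using \<Gamma>_surj[OF zero_carrier_vec vec(1)] .
  then have "G\<^sub>0 (lift \<psi>) \<bullet>c G\<^sub>0 (lift \<psi>) = 0"
    using Green_lift[OF \<psi> k(1)] reg_coreg_A0[OF \<psi>, of k k'] vec by (simp add: A0_iff)
  then show ?thesis
    using vec by simp
qed

text \<open>Takes the place of the formula through the adjoint of the gamma field: the boundary
  value is tested against \<open>\<Gamma>\<^sub>0\<close> of arbitrary elements of the adjoint
  rather than of defect elements.\<close>

lemma G1_lift:
  assumes "\<psi> \<in> H_minus A" "(k, k') \<in> adjoint_rel A"
  shows "G\<^sub>1 (lift \<psi>) \<bullet>c \<Gamma>\<^sub>0 (k, k') = \<psi> k + cinner (coreg \<psi>) k - cinner (reg \<psi>) k'"
  using Green_lift[OF assms] G0_lift[OF assms(1)] \<Gamma>_carrier[OF assms(2)] by simp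

lemma \<Gamma>_regularized:
  assumes f: "(f, f') \<in> rigged_adjoint_rel A" and ft: "ft \<in> H_minus A"
    and u: "f' + ft = embed_minus A u"
  shows "\<Gamma>\<^sub>0 (f + reg ft, u + coreg ft) = G\<^sub>0 (f, f')"
    and "\<Gamma>\<^sub>1 (f + reg ft, u + coreg ft) = G\<^sub>1 (f, f') + G\<^sub>1 (lift ft)"
proof -
  have "(f + reg ft, embed_minus A (u + coreg ft)) = (f, f') + lift ft"
    by (simp add: lift_def embed_minus_add add.assoc flip: u)
  then show "\<Gamma>\<^sub>0 (f + reg ft, u + coreg ft) = G\<^sub>0 (f, f')"
    "\<Gamma>\<^sub>1 (f + reg ft, u + coreg ft) = G\<^sub>1 (f, f') + G\<^sub>1 (lift ft)"
    using G_embed[OF regularized_mem_adjoint[OF f ft u]] G_add[OF f lift_mem[OF ft]]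
      G0_lift[OF ft] G_carrier[OF f] by simp_all
qed

lemma regularized_Green:
  assumes f: "(f, f') \<in> rigged_adjoint_rel A" "ft \<in> H_minus A" "f' + ft = embed_minus A u"
    and g: "(g, g') \<in> rigged_adjoint_rel A" "gt \<in> H_minus A" "g' + gt = embed_minus A v"
  shows "cinner u g - cinner f v =
    G\<^sub>1 (f, f') \<bullet>c G\<^sub>0 (g, g') - G\<^sub>0 (f, f') \<bullet>c G\<^sub>1 (g, g')
    - cnj (gt (f + reg ft)) + ft (g + reg gt)"
proof -
  note yf = regularized_mem_adjoint[OF f] and yg = regularized_mem_adjoint[OF g]
  note \<Gamma>f = \<Gamma>_regularized[OF f] and \<Gamma>g = \<Gamma>_regularized[OF g]
  note Gf = G_carrier[OF f(1)] and Gg = G_carrier[OF g(1)]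
  note Lf = G_carrier[OF lift_mem[OF f(2)]] and Lg = G_carrier[OF lift_mem[OF g(2)]]
  have 1: "cinner (u + coreg ft) (g + reg gt) - cinner (f + reg ft) (v + coreg gt) =
      G\<^sub>1 (f, f') \<bullet>c G\<^sub>0 (g, g') + G\<^sub>1 (lift ft) \<bullet>c G\<^sub>0 (g, g')
      - (G\<^sub>0 (f, f') \<bullet>c G\<^sub>1 (g, g') + G\<^sub>0 (f, f') \<bullet>c G\<^sub>1 (lift gt))"
    using Gf Gg Lf Lg
    by (simp add: Green[OF yf yg] \<Gamma>f \<Gamma>g add_scalar_prod_distrib[of _ p]
        conjugate_add_vec[of _ p] scalar_prod_add_distrib[of _ p])
  have 2: "G\<^sub>1 (lift ft) \<bullet>c G\<^sub>0 (g, g') =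
      ft (g + reg gt) + cinner (coreg ft) (g + reg gt) - cinner (reg ft) (v + coreg gt)"
    using G1_lift[OF f(2) yg] by (simp add: \<Gamma>g)
  \<comment> \<open>\<open>G1_lift\<close> has the lifted value on the left, so the roles of
    \<open>f\<close> and \<open>g\<close> are exchanged and the result is conjugated.\<close>
  have "G\<^sub>0 (f, f') \<bullet>c G\<^sub>1 (lift gt) = cnj (G\<^sub>1 (lift gt) \<bullet>c G\<^sub>0 (f, f'))"
    using cnj_cscalar_prod[OF Lg(2) Gf(1)] by simp
  also have "\<dots> = cnj (gt (f + reg ft) + cinner (coreg gt) (f + reg ft) - cinner (reg gt) (u + coreg ft))"
    using G1_lift[OF g(2) yf] by (simp add: \<Gamma>f)
  also have "\<dots> = cnj (gt (f + reg ft)) + cinner (f + reg ft) (coreg gt) - cinner (u + coreg ft) (reg gt)"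
    by (simp flip: cinner_commute)
  finally have 3: "G\<^sub>0 (f, f') \<bullet>c G\<^sub>1 (lift gt) =
      cnj (gt (f + reg ft)) + cinner (f + reg ft) (coreg gt) - cinner (u + coreg ft) (reg gt)" .
  show ?thesis
    \<comment> \<open>After substitution the mixed terms cancel except for one copy of
      \<open>cinner (coreg ft) (reg gt) - cinner (reg ft) (coreg gt)\<close>, which is zero by
      symmetry.\<close>
    using 1 2 3 reg_coreg_symmetric[OF f(2) g(2)]
    by (simp add: cinner_add_left cinner_add_right algebra_simps)
qed

end

theorem lemma3p9:
  fixes A :: "('a::complex_hilbert_space \<times> 'a) set"
    and p :: nat
    and \<Gamma>\<^sub>0 \<Gamma>\<^sub>1 :: "'a \<times> 'a \<Rightarrow> complex vec"
    and G\<^sub>0 G\<^sub>1 :: "'a \<times> ('a \<Rightarrow> complex) \<Rightarrow> complex vec"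
    and f g u v :: 'a
    and f' g' ft gt :: "'a \<Rightarrow> complex"
    and R :: "('a \<Rightarrow> complex) \<Rightarrow> 'a"
  assumes "linear_relation A" and "closed A" and "symmetric_rel A"
    and "defect_numbers A p p"
    and "extended_boundary_triple p A \<Gamma>\<^sub>0 \<Gamma>\<^sub>1 G\<^sub>0 G\<^sub>1"
    and "R = regularizer (ker_ext p A \<Gamma>\<^sub>0)"
    and "(f, f') \<in> rigged_adjoint_rel A" and "(g, g') \<in> rigged_adjoint_rel A"
    and "ft \<in> H_minus A" and "gt \<in> H_minus A"
    and "f' + ft = embed_minus A u" and "g' + gt = embed_minus A v"
  shows "f + R ft \<in> H_plus A \<and> g + R gt \<in> H_plus A \<and>
    cinner u g - cinner f v =
      G\<^sub>1 (f, f') \<bullet>c G\<^sub>0 (g, g') - G\<^sub>0 (f, f') \<bullet>c G\<^sub>1 (g, g')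
      - cnj (gt (f + R ft)) + ft (g + R gt)"
proof -
  interpret extended_triple_relation A p \<Gamma>\<^sub>0 \<Gamma>\<^sub>1 G\<^sub>0 G\<^sub>1
    using assms(1-3,5) by unfold_locales (simp_all add: extended_boundary_triple_def)
  have "f + reg ft \<in> H_plus A" "g + reg gt \<in> H_plus A"
    using regularized_mem_adjoint[OF assms(7,9,11)] regularized_mem_adjoint[OF assms(8,10,12)]
      adjoint_in_H_plus by blast+
  then show ?thesis
    using regularized_Green[OF assms(7,9,11,8,10,12)] by (simp add: assms(6))
qed

end
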